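(* Let $R$ be a commutative ring and let $n$ be a natural number. If there exist units $b,c\in U(R)$ such that $(b^m-1)R+(c^m-1)R=R$ for all natural numbers $m\ge 1$, then $GI^c_n(R)\subset[GA^c_n(R),GA^c_n(R)]^{(1)}$; that is, every element of $GI^c_n(R)$ is a single commutator of elements of $GA^c_n(R)$.
   Context: $U(R)$ is the group of units of $R$. $GA^c_n(R)$ is the group (under composition) of augmented continuous $R$-algebra automorphisms of $R[[X_1,\ldots,X_n]]$, where augmented and continuous are understood with respect to the ideal $\mathfrak M=(X_1,\ldots,X_n)R[[X_1,\ldots,X_n]]$ and the corresponding additive ($\mathfrak M$-adic) topology. Such an automorphism is determined by its values $X_i\mapsto h_i^{(1)}+h_i^{(2)}+\cdots$, with $h_i^{(j)}\in R[X_1,\ldots,X_n]$ homogeneous of degree $j$. $GI^c_n(R)$ is the kernel of the natural surjection $GA^c_n(R)\to\operatorname{Aut}(R[[X_1,\ldots,X_n]]/\mathfrak M^2)=GL_n(R)$, i.e. the group of those automorphisms with identity linear part. For a group $\Gamma$ and a natural number $k$, $[\Gamma,\Gamma]^{(k)}=\{[\beta_1,\gamma_1]\cdots[\beta_k,\gamma_k] : \beta_i,\gamma_i\in\Gamma\}$, where $[-,-]$ is the group commutator. *)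

theory Defs
  imports
    "HOL-Algebra.Bij"
    "HOL-Algebra.Generated_Groups"
    "HOL-Algebra.Ideal_Product"
    "HOL-Algebra.Indexed_Polynomials"
    "HOL-Algebra.QuotRing"
    "HOL-Analysis.Abstract_Topology"
begin

text \<open>As in \<^theory>\<open>HOL-Algebra.Indexed_Polynomials\<close>, a monomial is a multiset of
  variable indices, and \<^term>\<open>f m\<close> is the coefficient of \<^term>\<open>m\<close> in \<^term>\<open>f\<close>.  The variables
  are indexed by \<^term>\<open>{1..n}\<close>; coefficients at monomials involving any other index are zero.\<close>

definition power_series_ring :: "('a, 'b) ring_scheme \<Rightarrow> nat \<Rightarrow> (nat multiset \<Rightarrow> 'a) ring"
  where "power_series_ring R n =
    \<lparr> carrier = {f. (\<forall>m. f m \<in> carrier R) \<and> (\<forall>m. \<not> set_mset m \<subseteq> {1..n} \<longrightarrow> f m = \<zero>\<^bsub>R\<^esub>)},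
      monoid.mult = (\<lambda>f g m. \<Oplus>\<^bsub>R\<^esub>p\<in>{p. p \<subseteq># m}. f p \<otimes>\<^bsub>R\<^esub> g (m - p)),
      one = ring.indexed_const R \<one>\<^bsub>R\<^esub>,
      zero = ring.indexed_const R \<zero>\<^bsub>R\<^esub>,
      add = (\<lambda>f g m. f m \<oplus>\<^bsub>R\<^esub> g m) \<rparr>"

definition var_ideal :: "('a, 'b) ring_scheme \<Rightarrow> nat \<Rightarrow> (nat multiset \<Rightarrow> 'a) set"
  where "var_ideal R n = Idl\<^bsub>power_series_ring R n\<^esub> (ring.indexed_var R ` {1..n})"

definition ideal_power :: "('a, 'b) ring_scheme \<Rightarrow> 'a set \<Rightarrow> nat \<Rightarrow> 'a set"
  where "ideal_power Q I k = I [^]\<^bsub>ideals_set Q\<^esub> k"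

definition adic_topology :: "('a, 'b) ring_scheme \<Rightarrow> 'a set \<Rightarrow> 'a topology"
  where "adic_topology Q I =
    topology_generated_by {ideal_power Q I k +>\<^bsub>Q\<^esub> f | k f. f \<in> carrier Q}"

text \<open>As for \<^const>\<open>AutoGroup\<close>, automorphisms are extensional functions on the carrier.\<close>

definition ring_aut_group :: "('a, 'b) ring_scheme \<Rightarrow> ('a \<Rightarrow> 'a) monoid"
  where "ring_aut_group Q =
    BijGroup (carrier Q) \<lparr>carrier := ring_hom Q Q \<inter> Bij (carrier Q)\<rparr>"

definition GAc :: "('a, 'b) ring_scheme \<Rightarrow> nat
    \<Rightarrow> ((nat multiset \<Rightarrow> 'a) \<Rightarrow> (nat multiset \<Rightarrow> 'a)) monoid"
  where "GAc R n =
    (let P = power_series_ring R n; M = var_ideal R n; T = adic_topology P M in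
     ring_aut_group P \<lparr>carrier :=
       {\<phi> \<in> carrier (ring_aut_group P).
          (\<forall>r\<in>carrier R. \<phi> (ring.indexed_const R r) = ring.indexed_const R r) \<and>
          \<phi> ` M \<subseteq> M \<and>
          continuous_map T T \<phi>}\<rparr>)"

text \<open>The kernel of the map sending an automorphism to the one it induces on the quotient by
  the square of the ideal of the variables.  The kernel is insensitive to whether the codomain
  is the group of all ring automorphisms of the quotient or a subgroup of it, such as the
  augmented algebra automorphisms (that is, the general linear group).\<close>

definition GIc :: "('a, 'b) ring_scheme \<Rightarrow> nat
    \<Rightarrow> ((nat multiset \<Rightarrow> 'a) \<Rightarrow> (nat multiset \<Rightarrow> 'a)) set"
  where "GIc R n =
    (let P = power_series_ring R n; Q = P Quot ideal_power P (var_ideal R n) 2 in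
     kernel (GAc R n) (ring_aut_group Q) (\<lambda>\<phi>. \<lambda>C\<in>carrier Q. \<phi> ` C))"

text \<open>\<^const>\<open>derived_set\<close> collects the commutators
  \<^term>\<open>x \<otimes>\<^bsub>G\<^esub> y \<otimes>\<^bsub>G\<^esub> inv\<^bsub>G\<^esub> x \<otimes>\<^bsub>G\<^esub> inv\<^bsub>G\<^esub> y\<close> themselves, not the subgroup they generate.\<close>

primrec commutator_products :: "('a, 'b) monoid_scheme \<Rightarrow> nat \<Rightarrow> 'a set"
  where
    "commutator_products G 0 = {\<one>\<^bsub>G\<^esub>}"
  | "commutator_products G (Suc k) = commutator_products G k <#>\<^bsub>G\<^esub> derived_set G (carrier G)"

end

theory Submission
  imports Defs "Jordan_Normal_Form.Missing_Ring"
begin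

text \<open>
  Let \<open>f\<close> be an automorphism of \<open>R[[X\<^sub>1, \<dots>, X\<^sub>n]]\<close> with identity linear part.  The idea is to look
  for automorphisms \<open>\<phi>\<close> and \<open>\<psi>\<close> whose linear parts are the scalars \<open>b\<close> and \<open>c\<close> and which satisfy
  \<open>\<phi> \<circ> \<psi> = f \<circ> \<psi> \<circ> \<phi>\<close>, which says that \<open>f\<close> is the commutator of \<open>\<phi>\<close> and \<open>\<psi>\<close>.  Write
  \<open>\<phi> X\<^sub>i = p\<^sub>i\<close> and \<open>\<psi> X\<^sub>i = q\<^sub>i\<close>.  For \<open>p\<^sub>i = b X\<^sub>i\<close> and \<open>q\<^sub>i = c X\<^sub>i\<close> the two sides agree in degree 1,
  because scalars commute, and the higher degrees are corrected one after the other.  Suppose that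
  on every \<open>X\<^sub>i\<close> the difference of the two sides is a series \<open>e\<^sub>i\<close> without terms of degree less than
  \<open>N\<close>, where \<open>N \<ge> 2\<close>.  Adding \<open>s\<^sub>i\<close> to \<open>p\<^sub>i\<close> and \<open>t\<^sub>i\<close> to \<open>q\<^sub>i\<close>, both without terms of degree less than \<open>N\<close>,
  changes the difference in degree \<open>N\<close> to
  \<open>e\<^sub>i + c s\<^sub>i + b\<^sup>N t\<^sub>i - (b t\<^sub>i + c\<^sup>N s\<^sub>i) =
  e\<^sub>i - c (c\<^bsup>N-1\<^esup> - 1) s\<^sub>i + b (b\<^bsup>N-1\<^esup> - 1) t\<^sub>i\<close>.
  Since \<open>b\<close> and \<open>c\<close> are units and \<open>x (b\<^bsup>N-1\<^esup> - 1) + y (c\<^bsup>N-1\<^esup> - 1) = 1\<close> for suitable \<open>x\<close> and \<open>y\<close>, this vanishes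
  for \<open>s\<^sub>i = c\<^sup>-\<^sup>1 y e\<^sub>i\<close> and \<open>t\<^sub>i = - b\<^sup>-\<^sup>1 x e\<^sub>i\<close>.  This step is the lemma \<open>solves_below_step\<close>; its analytic
  content, the effect of a perturbation on a composite, is \<open>subst_perturb\<close>.  The corrections converge
  coefficientwise, and the limits are exact solutions (\<open>solution_exists\<close>).

  Three facts about power series carry the rest.  Any tuple of series without constant term is the
  tuple of values of an augmented endomorphism (\<open>subst_aug_endo\<close>), which is determined by these values
  (\<open>aug_endo_eqI\<close>); so an equation between endomorphisms may be tested on the variables.  An augmented
  endomorphism with scalar linear part \<open>u\<close> multiplies the terms of lowest degree \<open>k\<close> by \<open>u\<^sup>k\<close>
  (\<open>scalar_leading_term\<close>); if \<open>u\<close> is a unit, it is therefore bijective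
  (\<open>scalar_linear_part_bij\<close>).  Finally the \<open>k\<close>-th power of the ideal of the variables consists of the series
  without terms of degree less than \<open>k\<close> (\<open>ideal_power_eq\<close>), so that every augmented endomorphism is
  continuous (\<open>aug_endo_continuous\<close>) and the topology can be replaced by degrees.
\<close>

section \<open>The ring of formal power series\<close>

lemma finite_submultisets: "finite {p. p \<subseteq># (m :: 'b multiset)}"
proof (rule finite_subset)
  show "{p. p \<subseteq># m} \<subseteq> (\<Union>k\<le>size m. multisets_of_size (set_mset m) k)"
    by (auto simp: multisets_of_size_def dest: size_mset_mono set_mset_mono)
qed auto

text \<open>The equation that the correction terms in degree \<open>N\<close> have to satisfy, coefficient by coefficient:
  \<open>e\<close> is the present error, \<open>B\<close> and \<open>C\<close> are \<open>b\<^bsup>N-1\<^esup>\<close> and \<open>c\<^bsup>N-1\<^esup>\<close>, and \<open>y e\<close> and \<open>- x e\<close> are \<open>c s\<close>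
  and \<open>b t\<close>.\<close>
lemma (in cring) correction_identity:
  assumes "x \<in> carrier R" "y \<in> carrier R" "B \<in> carrier R" "C \<in> carrier R"
    "e \<in> carrier R" "w \<in> carrier R"
    and one: "x \<otimes> (B \<ominus> \<one>) \<oplus> y \<otimes> (C \<ominus> \<one>) = \<one>"
  shows "(w \<oplus> e) \<oplus> (y \<otimes> e \<oplus> B \<otimes> (\<ominus> (x \<otimes> e))) = w \<oplus> (\<ominus> (x \<otimes> e) \<oplus> C \<otimes> (y \<otimes> e))"
proof -
  have "e = (x \<otimes> (B \<ominus> \<one>) \<oplus> y \<otimes> (C \<ominus> \<one>)) \<otimes> e"
    using assms by simp
  also have "\<dots> = x \<otimes> B \<otimes> e \<ominus> x \<otimes> e \<oplus> (y \<otimes> C \<otimes> e \<ominus> y \<otimes> e)"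
    using assms(1-6) by algebra
  finally have "(w \<oplus> e) \<oplus> (y \<otimes> e \<oplus> B \<otimes> (\<ominus> (x \<otimes> e)))
      = (w \<oplus> (x \<otimes> B \<otimes> e \<ominus> x \<otimes> e \<oplus> (y \<otimes> C \<otimes> e \<ominus> y \<otimes> e))) \<oplus> (y \<otimes> e \<oplus> B \<otimes> (\<ominus> (x \<otimes> e)))"
    by simp
  also have "\<dots> = w \<oplus> (\<ominus> (x \<otimes> e) \<oplus> C \<otimes> (y \<otimes> e))"
    using assms(1-6) by algebra
  finally show ?thesis .
qed

locale power_series = cring R for R (structure) +
  fixes n :: nat
begin

abbreviation P where "P \<equiv> power_series_ring R n"

abbreviation const where "const \<equiv> indexed_const :: 'a \<Rightarrow> nat multiset \<Rightarrow> 'a"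

abbreviation var where "var \<equiv> indexed_var :: nat \<Rightarrow> nat multiset \<Rightarrow> 'a"

lemma carrier_P: "carrier P = {f. (\<forall>m. f m \<in> carrier R) \<and> (\<forall>m. \<not> set_mset m \<subseteq> {1..n} \<longrightarrow> f m = \<zero>)}"
  and mult_P: "f \<otimes>\<^bsub>P\<^esub> g = (\<lambda>m. \<Oplus>p\<in>{p. p \<subseteq># m}. f p \<otimes> g (m - p))"
  and one_P: "\<one>\<^bsub>P\<^esub> = const \<one>"
  and zero_P: "\<zero>\<^bsub>P\<^esub> = (\<lambda>m. \<zero>)"
  and add_P: "f \<oplus>\<^bsub>P\<^esub> g = (\<lambda>m. f m \<oplus> g m)"
  by (simp_all add: power_series_ring_def indexed_zero_def)

lemma coeff_closed: "f \<in> carrier P \<Longrightarrow> f m \<in> carrier R"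
  by (simp add: carrier_P)

lemma coeff_outside: "f \<in> carrier P \<Longrightarrow> \<not> set_mset m \<subseteq> {1..n} \<Longrightarrow> f m = \<zero>"
  by (simp add: carrier_P)

lemma carrier_PI:
  assumes "\<And>m. f m \<in> carrier R" "\<And>m. \<not> set_mset m \<subseteq> {1..n} \<Longrightarrow> f m = \<zero>"
  shows "f \<in> carrier P"
  using assms by (simp add: carrier_P)

(* Rewriting with coeff_closed and unfolding carrier_P at the same time does not terminate. *)
declare coeff_closed [simp]

lemma const_closed [simp]: "r \<in> carrier R \<Longrightarrow> const r \<in> carrier P"
  by (rule carrier_PI) (auto simp: indexed_const_def)

lemma mult_coeff_closed:
  assumes "f \<in> carrier P" "g \<in> carrier P"
  shows "(\<Oplus>p\<in>{p. p \<subseteq># m}. f p \<otimes> g (m - p)) \<in> carrier R"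
  using assms by (auto intro!: finsum_closed)

lemma mult_P_closed:
  assumes "f \<in> carrier P" "g \<in> carrier P"
  shows "f \<otimes>\<^bsub>P\<^esub> g \<in> carrier P"
proof (rule carrier_PI)
  fix m show "(f \<otimes>\<^bsub>P\<^esub> g) m \<in> carrier R"
    using assms by (simp add: mult_P mult_coeff_closed)
next
  fix m :: "nat multiset" assume m: "\<not> set_mset m \<subseteq> {1..n}"
  have "f p \<otimes> g (m - p) = \<zero>" if p: "p \<subseteq># m" for p
  proof -
    have "m = p + (m - p)" using p by simp
    then have "set_mset m = set_mset p \<union> set_mset (m - p)"
      by (metis set_mset_union)
    then consider "\<not> set_mset p \<subseteq> {1..n}" | "\<not> set_mset (m - p) \<subseteq> {1..n}"
      using m by auto
    then show ?thesis
      by cases (use assms in \<open>simp_all add: coeff_outside\<close>)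
  qed
  then show "(f \<otimes>\<^bsub>P\<^esub> g) m = \<zero>"
    unfolding mult_P by (intro add.finprod_one_eqI) auto
qed

lemma mult_P_comm:
  assumes "f \<in> carrier P" "g \<in> carrier P"
  shows "f \<otimes>\<^bsub>P\<^esub> g = g \<otimes>\<^bsub>P\<^esub> f"
proof
  fix m :: "nat multiset"
  have img: "(\<lambda>p. m - p) ` {p. p \<subseteq># m} = {p. p \<subseteq># m}"
  proof (intro equalityI subsetI)
    fix p assume "p \<in> {p. p \<subseteq># m}"
    then have "p = m - (m - p)" "m - p \<subseteq># m"
      by (auto simp: subset_mset.diff_diff_right)
    then show "p \<in> (\<lambda>p. m - p) ` {p. p \<subseteq># m}" by blast
  qed auto
  have inj: "inj_on (\<lambda>p. m - p) {p. p \<subseteq># m}"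
    by (rule inj_on_inverseI[where g = "\<lambda>p. m - p"]) (auto simp: subset_mset.diff_diff_right)
  have "(f \<otimes>\<^bsub>P\<^esub> g) m = (\<Oplus>p\<in>(\<lambda>p. m - p) ` {p. p \<subseteq># m}. f p \<otimes> g (m - p))"
    unfolding img by (simp add: mult_P)
  also have "\<dots> = (\<Oplus>p\<in>{p. p \<subseteq># m}. f (m - p) \<otimes> g (m - (m - p)))"
    by (rule finsum_reindex) (use assms inj in auto)
  also have "\<dots> = (\<Oplus>p\<in>{p. p \<subseteq># m}. g p \<otimes> f (m - p))"
    by (rule finsum_cong') (use assms in \<open>auto simp: m_comm subset_mset.diff_diff_right\<close>)
  finally show "(f \<otimes>\<^bsub>P\<^esub> g) m = (g \<otimes>\<^bsub>P\<^esub> f) m"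
    by (simp add: mult_P)
qed

text \<open>Both sides collect the terms \<open>a q \<otimes> b r \<otimes> c s\<close> with \<open>q + r + s = m\<close>.  On the left, \<open>q\<close> ranges over
  the submultisets of \<open>p = q + r\<close>; extending its range by zero to all submultisets of \<open>m\<close> makes the two
  sums exchangeable.\<close>
lemma mult_P_assoc:
  assumes a: "a \<in> carrier P" and b: "b \<in> carrier P" and c: "c \<in> carrier P"
  shows "(a \<otimes>\<^bsub>P\<^esub> b) \<otimes>\<^bsub>P\<^esub> c = a \<otimes>\<^bsub>P\<^esub> (b \<otimes>\<^bsub>P\<^esub> c)"
proof
  fix m :: "nat multiset"
  define S where "S = {p. p \<subseteq># m}"
  have S: "finite S" unfolding S_def by (rule finite_submultisets)
  define t where "t q p = (if q \<subseteq># p then a q \<otimes> b (p - q) \<otimes> c (m - p) else \<zero>)" for p q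
  have t: "t q p \<in> carrier R" for p q
    using assms by (auto simp: t_def)
  have "((a \<otimes>\<^bsub>P\<^esub> b) \<otimes>\<^bsub>P\<^esub> c) m = (\<Oplus>p\<in>S. (\<Oplus>q\<in>{q. q \<subseteq># p}. a q \<otimes> b (p - q)) \<otimes> c (m - p))"
    by (simp add: mult_P S_def)
  also have "\<dots> = (\<Oplus>p\<in>S. \<Oplus>q\<in>S. t q p)"
  proof (rule finsum_cong')
    fix p assume p: "p \<in> S"
    have "(\<Oplus>q\<in>{q. q \<subseteq># p}. a q \<otimes> b (p - q)) \<otimes> c (m - p)
        = (\<Oplus>q\<in>{q. q \<subseteq># p}. a q \<otimes> b (p - q) \<otimes> c (m - p))"
      by (rule finsum_ldistr) (use assms finite_submultisets in auto)
    also have "\<dots> = (\<Oplus>q\<in>S. t q p)"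
      by (rule add.finprod_mono_neutral_cong_left)
        (use S p t in \<open>auto simp: S_def t_def intro: subset_mset.order_trans\<close>)
    finally show "(\<Oplus>q\<in>{q. q \<subseteq># p}. a q \<otimes> b (p - q)) \<otimes> c (m - p) = (\<Oplus>q\<in>S. t q p)" .
  qed (use t in auto)
  also have "\<dots> = (\<Oplus>q\<in>S. \<Oplus>p\<in>S. t q p)"
    by (rule finsum_finsum_swap) (use S t in auto)
  also have "\<dots> = (\<Oplus>q\<in>S. a q \<otimes> (\<Oplus>r\<in>{r. r \<subseteq># m - q}. b r \<otimes> c (m - q - r)))"
  proof (rule finsum_cong')
    fix q assume q: "q \<in> S"
    have img: "(\<lambda>r. q + r) ` {r. r \<subseteq># m - q} = {p \<in> S. q \<subseteq># p}"
    proof (intro equalityI subsetI)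
      fix p assume "p \<in> {p \<in> S. q \<subseteq># p}"
      then have "p = q + (p - q)" "p - q \<subseteq># m - q"
        by (auto simp: S_def subset_eq_diff_conv)
      then show "p \<in> (\<lambda>r. q + r) ` {r. r \<subseteq># m - q}" by blast
    next
      fix p assume "p \<in> (\<lambda>r. q + r) ` {r. r \<subseteq># m - q}"
      then obtain r where "p = q + r" "r \<subseteq># m - q" by auto
      then show "p \<in> {p \<in> S. q \<subseteq># p}"
        using q by (simp add: S_def) (metis subset_mset.add_left_mono subset_mset.add_diff_inverse)
    qed
    have "(\<Oplus>p\<in>S. t q p) = (\<Oplus>p\<in>(\<lambda>r. q + r) ` {r. r \<subseteq># m - q}. t q p)"
      unfolding img
      by (rule add.finprod_mono_neutral_cong_right) (use S t in \<open>auto simp: t_def\<close>)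
    also have "\<dots> = (\<Oplus>r\<in>{r. r \<subseteq># m - q}. t q (q + r))"
      by (rule finsum_reindex) (use t in \<open>auto simp: inj_on_def\<close>)
    also have "\<dots> = (\<Oplus>r\<in>{r. r \<subseteq># m - q}. a q \<otimes> (b r \<otimes> c (m - q - r)))"
      by (rule finsum_cong') (use assms in \<open>auto simp: t_def m_assoc diff_diff_add_mset\<close>)
    also have "\<dots> = a q \<otimes> (\<Oplus>r\<in>{r. r \<subseteq># m - q}. b r \<otimes> c (m - q - r))"
      by (rule finsum_rdistr[symmetric]) (use assms finite_submultisets in auto)
    finally show "(\<Oplus>p\<in>S. t q p) = a q \<otimes> (\<Oplus>r\<in>{r. r \<subseteq># m - q}. b r \<otimes> c (m - q - r))" .
  qed (use assms in \<open>auto intro!: finsum_closed m_closed\<close>)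
  also have "\<dots> = (a \<otimes>\<^bsub>P\<^esub> (b \<otimes>\<^bsub>P\<^esub> c)) m"
    by (simp add: mult_P S_def)
  finally show "((a \<otimes>\<^bsub>P\<^esub> b) \<otimes>\<^bsub>P\<^esub> c) m = (a \<otimes>\<^bsub>P\<^esub> (b \<otimes>\<^bsub>P\<^esub> c)) m" .
qed

lemma coeff_const_mult:
  assumes r: "r \<in> carrier R" and g: "g \<in> carrier P"
  shows "(const r \<otimes>\<^bsub>P\<^esub> g) m = r \<otimes> g m"
proof -
  have "(const r \<otimes>\<^bsub>P\<^esub> g) m = (\<Oplus>p\<in>{{#}}. r \<otimes> g (m - p))"
    unfolding mult_P
    by (rule add.finprod_mono_neutral_cong_right)
      (use assms finite_submultisets in \<open>auto simp: indexed_const_def\<close>)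
  also have "\<dots> = r \<otimes> g m" using assms by simp
  finally show ?thesis .
qed

lemma cring_P: "cring P"
proof (rule cringI)
  show "abelian_group P"
  proof (rule abelian_groupI)
    show "f \<oplus>\<^bsub>P\<^esub> g \<in> carrier P" if "f \<in> carrier P" "g \<in> carrier P" for f g
      using that by (intro carrier_PI) (simp_all add: add_P coeff_outside)
    show "\<zero>\<^bsub>P\<^esub> \<in> carrier P"
      by (intro carrier_PI) (simp_all add: zero_P)
    fix f assume f: "f \<in> carrier P"
    then have "(\<lambda>m. \<ominus> f m) \<in> carrier P"
      by (intro carrier_PI) (simp_all add: coeff_outside)
    then show "\<exists>g\<in>carrier P. g \<oplus>\<^bsub>P\<^esub> f = \<zero>\<^bsub>P\<^esub>"
      by (rule bexI[rotated])
        (use f in \<open>auto simp: add_P zero_P fun_eq_iff l_neg\<close>)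
  qed (auto simp: add_P zero_P fun_eq_iff a_ac)
  show "comm_monoid P"
  proof (rule comm_monoidI)
    show "\<one>\<^bsub>P\<^esub> \<in> carrier P" by (simp add: one_P)
    show "\<one>\<^bsub>P\<^esub> \<otimes>\<^bsub>P\<^esub> f = f" if "f \<in> carrier P" for f
      using that by (simp add: one_P fun_eq_iff coeff_const_mult)
  qed (blast intro: mult_P_closed mult_P_comm mult_P_assoc)+
  show "(f \<oplus>\<^bsub>P\<^esub> g) \<otimes>\<^bsub>P\<^esub> h = f \<otimes>\<^bsub>P\<^esub> h \<oplus>\<^bsub>P\<^esub> g \<otimes>\<^bsub>P\<^esub> h"
    if "f \<in> carrier P" "g \<in> carrier P" "h \<in> carrier P" for f g h
    using that by (auto simp: add_P mult_P fun_eq_iff l_distr intro!: finsum_addf[symmetric] cong: finsum_cong)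
qed

sublocale P: cring P by (rule cring_P)

lemma coeff_zero: "\<zero>\<^bsub>P\<^esub> m = \<zero>"
  and coeff_add: "(f \<oplus>\<^bsub>P\<^esub> g) m = f m \<oplus> g m"
  by (simp_all add: zero_P add_P)

lemma coeff_uminus:
  assumes "f \<in> carrier P" shows "(\<ominus>\<^bsub>P\<^esub> f) m = \<ominus> f m"
proof -
  have "(\<ominus>\<^bsub>P\<^esub> f) m \<oplus> f m = \<zero>"
    using assms P.l_neg[of f] by (metis coeff_add coeff_zero)
  then show ?thesis
    using assms by (metis P.a_inv_closed coeff_closed minus_equality)
qed

lemma coeff_minus:
  assumes "f \<in> carrier P" "g \<in> carrier P" shows "(f \<ominus>\<^bsub>P\<^esub> g) m = f m \<ominus> g m"
  using assms by (simp add: a_minus_def coeff_add coeff_uminus)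

lemmas coeff_simps = coeff_zero coeff_add coeff_uminus coeff_minus

lemma const_mult: "const (r \<otimes> s) = const r \<otimes>\<^bsub>P\<^esub> const s" if "r \<in> carrier R" "s \<in> carrier R"
  using that by (auto simp: fun_eq_iff coeff_const_mult) (auto simp: indexed_const_def)

lemma var_eq: "var i = (\<lambda>m. if m = {#i#} then \<one> else \<zero>)"
  by (auto simp: indexed_var_def indexed_pmult_def indexed_const_def fun_eq_iff
      dest: multi_member_split)

lemma var_closed [simp]: "i \<in> {1..n} \<Longrightarrow> var i \<in> carrier P"
  by (rule carrier_PI) (auto simp: var_eq)

lemma coeff_var_mult:
  assumes i: "i \<in> {1..n}" and g: "g \<in> carrier P"
  shows "(var i \<otimes>\<^bsub>P\<^esub> g) m = (if i \<in># m then g (m - {#i#}) else \<zero>)"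
proof (cases "i \<in># m")
  case True
  have "(var i \<otimes>\<^bsub>P\<^esub> g) m = (\<Oplus>p\<in>{{#i#}}. \<one> \<otimes> g (m - p))"
    unfolding mult_P
    by (rule add.finprod_mono_neutral_cong_right)
      (use assms True finite_submultisets in \<open>auto simp: var_eq\<close>)
  then show ?thesis using assms True by simp
next
  case False
  then have "var i p \<otimes> g (m - p) = \<zero>" if "p \<subseteq># m" for p
    using that g by (auto simp: var_eq)
  then show ?thesis
    using False unfolding mult_P by (auto intro!: add.finprod_one_eqI)
qed

section \<open>The filtration by degree\<close>

text \<open>This turns out to be the \<open>k\<close>-th power of the ideal of the variables, see \<open>ideal_power_eq\<close>.
  In comments, a series of order \<open>k\<close> means one in this set; its lowest terms may have higher degree.\<close>
definition vanishing_below :: "nat \<Rightarrow> (nat multiset \<Rightarrow> 'a) set"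
  where "vanishing_below k = {f \<in> carrier P. \<forall>m. size m < k \<longrightarrow> f m = \<zero>}"

abbreviation \<F> where "\<F> \<equiv> vanishing_below"

lemma F_carrier: "f \<in> \<F> k \<Longrightarrow> f \<in> carrier P"
  by (simp add: vanishing_below_def)

lemma F_0: "\<F> 0 = carrier P"
  by (auto simp: vanishing_below_def)

lemma F_mono: "f \<in> \<F> k \<Longrightarrow> j \<le> k \<Longrightarrow> f \<in> \<F> j"
  by (auto simp: vanishing_below_def)

lemma F_zero [simp]: "\<zero>\<^bsub>P\<^esub> \<in> \<F> k"
  by (simp add: vanishing_below_def coeff_simps)

lemma F_add: "f \<in> \<F> k \<Longrightarrow> g \<in> \<F> k \<Longrightarrow> f \<oplus>\<^bsub>P\<^esub> g \<in> \<F> k"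
  by (simp add: vanishing_below_def coeff_simps)

lemma F_uminus: "f \<in> \<F> k \<Longrightarrow> \<ominus>\<^bsub>P\<^esub> f \<in> \<F> k"
  by (simp add: vanishing_below_def coeff_simps)

lemma F_mult:
  assumes f: "f \<in> \<F> j" and g: "g \<in> \<F> k"
  shows "f \<otimes>\<^bsub>P\<^esub> g \<in> \<F> (j + k)"
proof -
  have "f p \<otimes> g (m - p) = \<zero>" if m: "size m < j + k" and p: "p \<subseteq># m" for m p
  proof -
    have "size m = size p + size (m - p)"
      using p by (metis size_union subset_mset.add_diff_inverse)
    then consider "size p < j" | "size (m - p) < k" using m by linarith
    then show ?thesis
      by cases (use f g in \<open>auto simp: vanishing_below_def\<close>)
  qed
  then have "(f \<otimes>\<^bsub>P\<^esub> g) m = \<zero>" if "size m < j + k" for m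
    using that unfolding mult_P by (intro add.finprod_one_eqI) auto
  then show ?thesis
    using f g by (simp add: vanishing_below_def)
qed

lemma F_mult_left: "f \<in> carrier P \<Longrightarrow> g \<in> \<F> k \<Longrightarrow> f \<otimes>\<^bsub>P\<^esub> g \<in> \<F> k"
  using F_mult[of f 0 g k] by (simp add: F_0)

lemma F_mult_right: "f \<in> \<F> k \<Longrightarrow> g \<in> carrier P \<Longrightarrow> f \<otimes>\<^bsub>P\<^esub> g \<in> \<F> k"
  using F_mult[of f k g 0] by (simp add: F_0)

lemma var_F [simp]: "i \<in> {1..n} \<Longrightarrow> var i \<in> \<F> 1"
  using var_closed[of i] by (auto simp: vanishing_below_def var_eq)

lemma F_Inter: "(\<And>k. f \<in> \<F> k) \<Longrightarrow> f = \<zero>\<^bsub>P\<^esub>"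
  by (auto simp: vanishing_below_def fun_eq_iff coeff_simps)

lemma minus_const_F: "f \<in> carrier P \<Longrightarrow> f \<ominus>\<^bsub>P\<^esub> const (f {#}) \<in> \<F> 1"
  by (simp add: vanishing_below_def coeff_simps) (simp add: indexed_const_def a_minus_def r_neg)

text \<open>An element of \<open>\<F> (Suc k)\<close> is a finite sum of products \<open>X\<^sub>i h\<close> with \<open>h\<close> in \<open>\<F> k\<close>: the monomials that contain a chosen variable are divisible by it, and the rest of the series involves
  fewer variables.  With this rule, statements about infinite series become inductions on the
  degree in which one factor \<open>X\<^sub>i\<close> is split off at a time.\<close>
lemma F_Suc_induct [consumes 1, case_names zero add var_mult]:
  assumes g: "g \<in> \<F> (Suc k)"
    and zero: "Q \<zero>\<^bsub>P\<^esub>"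
    and add: "\<And>f g. f \<in> carrier P \<Longrightarrow> g \<in> carrier P \<Longrightarrow> Q f \<Longrightarrow> Q g \<Longrightarrow> Q (f \<oplus>\<^bsub>P\<^esub> g)"
    and var_mult: "\<And>i h. i \<in> {1..n} \<Longrightarrow> h \<in> \<F> k \<Longrightarrow> Q (var i \<otimes>\<^bsub>P\<^esub> h)"
  shows "Q g"
proof -
  have "\<forall>g\<in>\<F> (Suc k). (\<forall>m. g m \<noteq> \<zero> \<longrightarrow> set_mset m \<subseteq> S) \<longrightarrow> Q g"
    if "finite S" "S \<subseteq> {1..n}" for S
    using that
  proof (induction S)
    case empty
    have "g = \<zero>\<^bsub>P\<^esub>" if "g \<in> \<F> (Suc k)" "\<forall>m. g m \<noteq> \<zero> \<longrightarrow> m = {#}" for g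
      using that by (force simp: vanishing_below_def fun_eq_iff coeff_simps)
    then show ?case using zero by auto
  next
    case (insert i S)
    then have i: "i \<in> {1..n}" by simp
    show ?case
    proof (intro ballI impI)
      fix g assume g: "g \<in> \<F> (Suc k)" and supp: "\<forall>m. g m \<noteq> \<zero> \<longrightarrow> set_mset m \<subseteq> insert i S"
      define h where "h = (\<lambda>m. g (add_mset i m))"
      define g' where "g' = (\<lambda>m. if i \<in># m then \<zero> else g m)"
      note gP = F_carrier[OF g]
      have "h \<in> carrier P"
        unfolding h_def
        by (rule carrier_PI, simp add: gP, rule coeff_outside[OF gP], auto)
      moreover have "g' \<in> carrier P"
        unfolding g'_def
        by (rule carrier_PI) (use gP in \<open>simp_all add: coeff_outside[OF gP]\<close>)
      ultimately have h: "h \<in> \<F> k" and g': "g' \<in> \<F> (Suc k)"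
        using g by (auto simp: h_def g'_def vanishing_below_def)
      have "g = var i \<otimes>\<^bsub>P\<^esub> h \<oplus>\<^bsub>P\<^esub> g'"
        using i F_carrier[OF g] F_carrier[OF h]
        by (auto simp: fun_eq_iff coeff_simps coeff_var_mult h_def g'_def)
      moreover have "Q g'"
      proof -
        have "\<forall>m. g' m \<noteq> \<zero> \<longrightarrow> set_mset m \<subseteq> S"
        proof (intro allI impI)
          fix m assume "g' m \<noteq> \<zero>"
          then have "i \<notin># m" "g m \<noteq> \<zero>" by (auto simp: g'_def split: if_splits)
          then show "set_mset m \<subseteq> S" using supp by blast
        qed
        then show ?thesis using insert.IH insert.prems g' by simp
      qed
      ultimately show "Q g"
        using add[OF _ _ var_mult[OF i h], of g'] i F_carrier[OF h] F_carrier[OF g'] by simp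
    qed
  qed
  from this[of "{1..n}"] have "\<forall>g\<in>\<F> (Suc k). (\<forall>m. g m \<noteq> \<zero> \<longrightarrow> set_mset m \<subseteq> {1..n}) \<longrightarrow> Q g"
    by simp
  moreover have "\<forall>m. g m \<noteq> \<zero> \<longrightarrow> set_mset m \<subseteq> {1..n}"
    using coeff_outside[OF F_carrier[OF g]] by metis
  ultimately show ?thesis
    using g by metis
qed

end

section \<open>Congruence and limits\<close>

context power_series
begin

text \<open>Congruence modulo \<open>\<F> k\<close> (see \<open>agree_iff_minus\<close>).  Comparing coefficients instead
  of subtracting makes it an equivalence relation on all functions, also outside the carrier.\<close>
definition agree :: "nat \<Rightarrow> (nat multiset \<Rightarrow> 'a) \<Rightarrow> (nat multiset \<Rightarrow> 'a) \<Rightarrow> bool"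
  where "agree k f g \<longleftrightarrow> (\<forall>m. size m < k \<longrightarrow> f m = g m)"

lemma agree_0 [simp]: "agree 0 f g"
  and agree_refl [simp]: "agree k f f"
  by (simp_all add: agree_def)

lemma agree_sym: "agree k f g \<Longrightarrow> agree k g f"
  by (simp add: agree_def)

lemma agree_trans [trans]: "agree k f g \<Longrightarrow> agree k g h \<Longrightarrow> agree k f h"
  by (simp add: agree_def)

lemma agree_mono: "agree k f g \<Longrightarrow> j \<le> k \<Longrightarrow> agree j f g"
  by (simp add: agree_def)

lemma agree_eqI: "(\<And>k. agree k f g) \<Longrightarrow> f = g"
  unfolding agree_def by (metis lessI ext)

lemma agree_add: "agree k f f' \<Longrightarrow> agree k g g' \<Longrightarrow> agree k (f \<oplus>\<^bsub>P\<^esub> g) (f' \<oplus>\<^bsub>P\<^esub> g')"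
  by (simp add: agree_def coeff_simps)

lemma agree_iff_minus:
  assumes f: "f \<in> carrier P" and g: "g \<in> carrier P"
  shows "agree k f g \<longleftrightarrow> f \<ominus>\<^bsub>P\<^esub> g \<in> \<F> k"
proof -
  have "f m = g m \<longleftrightarrow> f m \<ominus> g m = \<zero>" for m
    using f g by (metis coeff_closed r_right_minus_eq)
  then show ?thesis
    using f g by (simp add: agree_def vanishing_below_def coeff_minus)
qed

lemma agree_F: "f \<in> carrier P \<Longrightarrow> agree k f g \<Longrightarrow> g \<in> \<F> k \<Longrightarrow> f \<in> \<F> k"
  by (simp add: agree_def vanishing_below_def)

text \<open>A factor of order \<open>k\<close> improves a congruence by \<open>k\<close> degrees.  This gain is what makes the inductions
  on the degree work.\<close>
lemma agree_mult_F:
  assumes f: "f \<in> carrier P" and f': "f' \<in> carrier P" and "agree j f f'" and g: "g \<in> \<F> k"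
  shows "agree (j + k) (f \<otimes>\<^bsub>P\<^esub> g) (f' \<otimes>\<^bsub>P\<^esub> g)"
proof -
  note gP = F_carrier[OF g]
  have "f \<ominus>\<^bsub>P\<^esub> f' \<in> \<F> j"
    using assms by (simp add: agree_iff_minus)
  then have "(f \<ominus>\<^bsub>P\<^esub> f') \<otimes>\<^bsub>P\<^esub> g \<in> \<F> (j + k)"
    using g by (rule F_mult)
  moreover have "(f \<ominus>\<^bsub>P\<^esub> f') \<otimes>\<^bsub>P\<^esub> g = f \<otimes>\<^bsub>P\<^esub> g \<ominus>\<^bsub>P\<^esub> f' \<otimes>\<^bsub>P\<^esub> g"
    using f f' gP by (simp add: a_minus_def P.l_distr P.l_minus)
  ultimately show ?thesis
    using f f' gP by (simp add: agree_iff_minus)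
qed

lemma agree_F_mult:
  assumes "f \<in> carrier P" "f' \<in> carrier P" "agree j f f'" "g \<in> \<F> k"
  shows "agree (k + j) (g \<otimes>\<^bsub>P\<^esub> f) (g \<otimes>\<^bsub>P\<^esub> f')"
  using agree_mult_F[OF assms] assms F_carrier[OF assms(4)]
  by (simp add: P.m_comm add.commute)

lemma const_decomp:
  assumes "f \<in> carrier P"
  obtains d where "d \<in> \<F> 1" "f = const (f {#}) \<oplus>\<^bsub>P\<^esub> d"
proof
  show "f \<ominus>\<^bsub>P\<^esub> const (f {#}) \<in> \<F> 1"
    using assms by (rule minus_const_F)
  show "f = const (f {#}) \<oplus>\<^bsub>P\<^esub> (f \<ominus>\<^bsub>P\<^esub> const (f {#}))"
    using assms P.add.inv_solve_right' P.minus_eq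
    by (metis P.a_comm P.minus_closed coeff_closed const_closed P.add.m_comm P.add.inv_solve_right)
qed

text \<open>If each step \<open>s (Suc N)\<close> changes \<open>s N\<close> only in degrees \<open>N\<close> and above, then the coefficient at \<open>m\<close> is
  final from index \<open>Suc (size m)\<close> on.\<close>
definition limit :: "(nat \<Rightarrow> nat multiset \<Rightarrow> 'a) \<Rightarrow> nat multiset \<Rightarrow> 'a"
  where "limit s = (\<lambda>m. s (Suc (size m)) m)"

lemma limit_closed:
  assumes "\<And>N. s N \<in> carrier P"
  shows "limit s \<in> carrier P"
  unfolding limit_def
  by (rule carrier_PI) (use assms in \<open>simp_all add: coeff_outside\<close>)

lemma agree_limit:
  assumes "\<And>N. agree N (s (Suc N)) (s N)"
  shows "agree N (limit s) (s N)"
proof -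
  have "agree j (s (j + i)) (s j)" for i j
  proof (induction i)
    case (Suc i)
    have "agree j (s (Suc (j + i))) (s (j + i))"
      by (rule agree_mono[OF assms]) simp
    then show ?case using Suc by (auto intro: agree_trans)
  qed simp
  then have "s N m = s (Suc (size m)) m" if "size m < N" for m
    using that unfolding agree_def
    by (metis Suc_leI le_add_diff_inverse lessI)
  then show ?thesis
    by (simp add: agree_def limit_def)
qed

section \<open>Augmented endomorphisms\<close>

text \<open>Continuity is automatic (\<open>aug_endo_continuous\<close>).  The values outside the carrier are arbitrary,
  which makes these maps closed under ordinary composition; the elements of the automorphism group are the
  extensional bijective ones (\<open>carrier_GAc\<close>).\<close>
definition aug_endo :: "((nat multiset \<Rightarrow> 'a) \<Rightarrow> (nat multiset \<Rightarrow> 'a)) set"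
  where "aug_endo = {\<phi> \<in> ring_hom P P. (\<forall>r\<in>carrier R. \<phi> (const r) = const r) \<and> \<phi> ` \<F> 1 \<subseteq> \<F> 1}"

lemma aug_endo_hom: "\<phi> \<in> aug_endo \<Longrightarrow> ring_hom_cring P P \<phi>"
  by (intro ring_hom_cring.intro ring_hom_cring_axioms.intro cring_P) (simp add: aug_endo_def)

lemma aug_endo_closed [simp]: "\<phi> \<in> aug_endo \<Longrightarrow> f \<in> carrier P \<Longrightarrow> \<phi> f \<in> carrier P"
  using ring_hom_closed[of \<phi> P P f] by (simp add: aug_endo_def)

lemma aug_endo_add:
  "\<phi> \<in> aug_endo \<Longrightarrow> f \<in> carrier P \<Longrightarrow> g \<in> carrier P \<Longrightarrow> \<phi> (f \<oplus>\<^bsub>P\<^esub> g) = \<phi> f \<oplus>\<^bsub>P\<^esub> \<phi> g"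
  using ring_hom_add[of \<phi> P P f g] by (simp add: aug_endo_def)

lemma aug_endo_mult:
  "\<phi> \<in> aug_endo \<Longrightarrow> f \<in> carrier P \<Longrightarrow> g \<in> carrier P \<Longrightarrow> \<phi> (f \<otimes>\<^bsub>P\<^esub> g) = \<phi> f \<otimes>\<^bsub>P\<^esub> \<phi> g"
  using ring_hom_mult[of \<phi> P P f g] by (simp add: aug_endo_def)

lemma aug_endo_zero: "\<phi> \<in> aug_endo \<Longrightarrow> \<phi> \<zero>\<^bsub>P\<^esub> = \<zero>\<^bsub>P\<^esub>"
  using ring_hom_zero[of \<phi> P P] P.ring_axioms by (simp add: aug_endo_def)

lemma aug_endo_minus:
  "\<phi> \<in> aug_endo \<Longrightarrow> f \<in> carrier P \<Longrightarrow> g \<in> carrier P \<Longrightarrow> \<phi> (f \<ominus>\<^bsub>P\<^esub> g) = \<phi> f \<ominus>\<^bsub>P\<^esub> \<phi> g"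
  unfolding P.minus_eq
  using ring_hom_cring.hom_a_inv[OF aug_endo_hom, of \<phi> g] aug_endo_add[of \<phi> f "\<ominus>\<^bsub>P\<^esub> g"]
  by (metis P.a_inv_closed)

lemma aug_endo_const: "\<phi> \<in> aug_endo \<Longrightarrow> r \<in> carrier R \<Longrightarrow> \<phi> (const r) = const r"
  by (simp add: aug_endo_def)

lemma aug_endo_F1: "\<phi> \<in> aug_endo \<Longrightarrow> f \<in> \<F> 1 \<Longrightarrow> \<phi> f \<in> \<F> 1"
  by (auto simp: aug_endo_def)

lemma aug_endo_comp: "\<phi> \<in> aug_endo \<Longrightarrow> \<psi> \<in> aug_endo \<Longrightarrow> \<phi> \<circ> \<psi> \<in> aug_endo"
  using ring_hom_trans[of \<psi> P P \<phi> P] by (simp add: aug_endo_def) blast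

lemma aug_endo_F:
  assumes \<phi>: "\<phi> \<in> aug_endo"
  shows "g \<in> \<F> k \<Longrightarrow> \<phi> g \<in> \<F> k"
proof (induction k arbitrary: g)
  case 0
  then show ?case using \<phi> by (simp add: F_0)
next
  case (Suc k)
  from Suc.prems show ?case
  proof (induction rule: F_Suc_induct)
    case (var_mult i h)
    have "\<phi> (var i) \<otimes>\<^bsub>P\<^esub> \<phi> h \<in> \<F> (1 + k)"
      by (intro F_mult aug_endo_F1[OF \<phi>] var_F var_mult Suc.IH)
    then show ?case
      using \<phi> var_mult by (simp add: aug_endo_mult F_carrier)
  qed (use \<phi> in \<open>auto simp: aug_endo_zero aug_endo_add F_add\<close>)
qed

lemma aug_endo_agree:
  assumes "\<phi> \<in> aug_endo" "f \<in> carrier P" "g \<in> carrier P" "agree k f g"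
  shows "agree k (\<phi> f) (\<phi> g)"
  using assms aug_endo_F[OF assms(1), of "f \<ominus>\<^bsub>P\<^esub> g" k]
  by (simp add: agree_iff_minus aug_endo_minus)

text \<open>The common step of the next two lemmas: replacing \<open>\<phi>\<close> by \<open>\<psi>\<close> on the factor \<open>X\<^sub>i\<close> is harmless because the
  other factor has order \<open>k\<close>, and replacing it on \<open>h\<close> because \<open>\<psi> X\<^sub>i\<close> has order 1.\<close>
lemma agree_endo_var_mult:
  assumes \<phi>: "\<phi> \<in> aug_endo" and \<psi>: "\<psi> \<in> aug_endo" and i: "i \<in> {1..n}"
    and var: "agree (Suc N) (\<phi> (var i)) (\<psi> (var i))"
    and h: "h \<in> \<F> k" and agr: "agree (N + k) (\<phi> h) (\<psi> h)"
  shows "agree (Suc (N + k)) (\<phi> (var i \<otimes>\<^bsub>P\<^esub> h)) (\<psi> (var i \<otimes>\<^bsub>P\<^esub> h))"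
proof -
  note c = F_carrier[OF h] var_closed[OF i]
  have "agree (Suc N + k) (\<phi> (var i) \<otimes>\<^bsub>P\<^esub> \<phi> h) (\<psi> (var i) \<otimes>\<^bsub>P\<^esub> \<phi> h)"
    by (rule agree_mult_F) (use \<phi> \<psi> c h var in \<open>auto intro: aug_endo_F\<close>)
  moreover have "agree (1 + (N + k)) (\<psi> (var i) \<otimes>\<^bsub>P\<^esub> \<phi> h) (\<psi> (var i) \<otimes>\<^bsub>P\<^esub> \<psi> h)"
    by (rule agree_F_mult) (use \<phi> \<psi> c agr i in \<open>simp_all only: aug_endo_closed aug_endo_F1 var_F\<close>)
  ultimately show ?thesis
    using \<phi> \<psi> c by (auto simp: aug_endo_mult intro: agree_trans)
qed

text \<open>By induction on the degree of agreement up to \<open>N\<close>: constants are fixed by both maps, and every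
  factor \<open>X\<^sub>i\<close> that is split off raises the agreement of the cofactor by one degree.\<close>
lemma agree_endo:
  assumes \<phi>: "\<phi> \<in> aug_endo" and \<psi>: "\<psi> \<in> aug_endo"
    and var: "\<And>i. i \<in> {1..n} \<Longrightarrow> agree N (\<phi> (var i)) (\<psi> (var i))"
    and g: "g \<in> carrier P"
  shows "agree N (\<phi> g) (\<psi> g)"
proof -
  have "\<forall>g\<in>carrier P. agree j (\<phi> g) (\<psi> g)" if "j \<le> N" for j
    using that
  proof (induction j)
    case 0
    then show ?case by simp
  next
    case (Suc j)
    then have IH: "agree j (\<phi> h) (\<psi> h)" if "h \<in> carrier P" for h
      using that by simp
    have d: "agree (Suc j) (\<phi> d) (\<psi> d)" if "d \<in> \<F> 1" for d
      using that[unfolded One_nat_def]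
    proof (induction rule: F_Suc_induct)
      case (var_mult i h)
      have "agree (Suc (j + 0)) (\<phi> (var i \<otimes>\<^bsub>P\<^esub> h)) (\<psi> (var i \<otimes>\<^bsub>P\<^esub> h))"
        by (rule agree_endo_var_mult[OF \<phi> \<psi> var_mult(1) _ var_mult(2)])
          (use var_mult Suc.prems IH var F_0 in \<open>auto intro: agree_mono\<close>)
      then show ?case by simp
    qed (use \<phi> \<psi> in \<open>auto simp: aug_endo_zero aug_endo_add agree_add\<close>)
    show ?case
    proof
      fix g assume g: "g \<in> carrier P"
      obtain d where d1: "d \<in> \<F> 1" and gd: "g = const (g {#}) \<oplus>\<^bsub>P\<^esub> d"
        using const_decomp[OF g] .
      have "\<phi> g = const (g {#}) \<oplus>\<^bsub>P\<^esub> \<phi> d" "\<psi> g = const (g {#}) \<oplus>\<^bsub>P\<^esub> \<psi> d"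
        using \<phi> \<psi> g F_carrier[OF d1]
        by (subst gd, simp add: aug_endo_add aug_endo_const)+
      then show "agree (Suc j) (\<phi> g) (\<psi> g)"
        using d[OF d1] by (simp add: agree_add)
    qed
  qed
  then show ?thesis using g by blast
qed

text \<open>The values at a product of \<open>k\<close> variables agree in \<open>k - 1\<close> more degrees than those at a single
  variable: in each term of their difference one factor is a difference of values at a variable,
  and the other \<open>k - 1\<close> factors have order 1.\<close>
lemma agree_endo_F:
  assumes \<phi>: "\<phi> \<in> aug_endo" and \<psi>: "\<psi> \<in> aug_endo"
    and var: "\<And>i. i \<in> {1..n} \<Longrightarrow> agree (Suc N) (\<phi> (var i)) (\<psi> (var i))"
  shows "g \<in> \<F> k \<Longrightarrow> agree (N + k) (\<phi> g) (\<psi> g)"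
proof (induction k arbitrary: g)
  case 0
  then show ?case
    using agree_mono[OF agree_endo[OF \<phi> \<psi> var], of g N] by (simp add: F_0)
next
  case (Suc k)
  from Suc.prems show ?case
  proof (induction rule: F_Suc_induct)
    case (var_mult i h)
    then show ?case
      using agree_endo_var_mult[OF \<phi> \<psi> var_mult(1) var var_mult(2) Suc.IH] by simp
  qed (use \<phi> \<psi> in \<open>auto simp: aug_endo_zero aug_endo_add agree_add\<close>)
qed

lemma aug_endo_eqI:
  assumes "\<phi> \<in> aug_endo" "\<psi> \<in> aug_endo" "\<And>i. i \<in> {1..n} \<Longrightarrow> \<phi> (var i) = \<psi> (var i)"
    and "g \<in> carrier P"
  shows "\<phi> g = \<psi> g"
  using agree_endo[OF assms(1,2)] assms(3,4) by (intro agree_eqI) simp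

text \<open>The induced map modulo \<open>\<F> 2\<close> is given by the scalar matrix \<open>u\<close>.\<close>
definition scalar_linear_part :: "'a \<Rightarrow> ((nat multiset \<Rightarrow> 'a) \<Rightarrow> (nat multiset \<Rightarrow> 'a)) \<Rightarrow> bool"
  where "scalar_linear_part u \<phi> \<longleftrightarrow>
    (\<forall>i\<in>{1..n}. agree 2 (\<phi> (var i)) (const u \<otimes>\<^bsub>P\<^esub> var i))"

text \<open>A monomial of degree \<open>k\<close> is a product of \<open>k\<close> variables, each of which contributes a factor \<open>u\<close> up to
  terms of higher degree.\<close>
lemma scalar_leading_term:
  assumes \<phi>: "\<phi> \<in> aug_endo" and u: "u \<in> carrier R" and lin: "scalar_linear_part u \<phi>"
  shows "g \<in> \<F> k \<Longrightarrow> agree (Suc k) (\<phi> g) (const (u [^] k) \<otimes>\<^bsub>P\<^esub> g)"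
proof (induction k arbitrary: g)
  case 0
  then have g: "g \<in> carrier P" by (simp add: F_0)
  obtain d where d: "d \<in> \<F> 1" and gd: "g = const (g {#}) \<oplus>\<^bsub>P\<^esub> d"
    using const_decomp[OF g] .
  have "\<phi> g = const (g {#}) \<oplus>\<^bsub>P\<^esub> \<phi> d"
    using \<phi> g F_carrier[OF d] by (subst gd) (simp add: aug_endo_add aug_endo_const)
  moreover have "agree 1 (\<phi> d) d"
    using aug_endo_F1[OF \<phi> d] d by (simp add: agree_def vanishing_below_def)
  ultimately have "agree 1 (\<phi> g) (const (g {#}) \<oplus>\<^bsub>P\<^esub> d)"
    by (simp add: agree_add)
  then show ?case
    using g gd by (simp flip: one_P)
next
  case (Suc k)
  from Suc.prems show ?case
  proof (induction rule: F_Suc_induct)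
    case zero
    show ?case using \<phi> u by (simp add: aug_endo_zero)
  next
    case (add f g)
    then show ?case using \<phi> u by (simp add: aug_endo_add P.r_distr agree_add del: nat_pow_Suc)
  next
    case (var_mult i h)
    note c = F_carrier[OF var_mult(2)] var_closed[OF var_mult(1)]
    have "agree (2 + k) (\<phi> (var i) \<otimes>\<^bsub>P\<^esub> \<phi> h) ((const u \<otimes>\<^bsub>P\<^esub> var i) \<otimes>\<^bsub>P\<^esub> \<phi> h)"
      by (rule agree_mult_F)
        (use \<phi> u lin c var_mult in \<open>auto simp: scalar_linear_part_def intro: aug_endo_F\<close>)
    moreover have "agree (1 + Suc k) ((const u \<otimes>\<^bsub>P\<^esub> var i) \<otimes>\<^bsub>P\<^esub> \<phi> h)
        ((const u \<otimes>\<^bsub>P\<^esub> var i) \<otimes>\<^bsub>P\<^esub> (const (u [^] k) \<otimes>\<^bsub>P\<^esub> h))"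
      by (rule agree_F_mult)
        (use \<phi> u c var_mult Suc.IH F_mult_left[OF const_closed[OF u] var_F] in simp_all)
    moreover have "(const u \<otimes>\<^bsub>P\<^esub> var i) \<otimes>\<^bsub>P\<^esub> (const (u [^] k) \<otimes>\<^bsub>P\<^esub> h)
        = const (u [^] Suc k) \<otimes>\<^bsub>P\<^esub> (var i \<otimes>\<^bsub>P\<^esub> h)"
      using u c by (simp add: const_mult P.m_ac)
    ultimately show ?case
      using \<phi> c by (auto simp: aug_endo_mult intro: agree_trans)
  qed
qed

lemma const_unit_cancel:
  assumes "u \<in> Units R" "g \<in> carrier P"
  shows "const (inv u [^] (k::nat)) \<otimes>\<^bsub>P\<^esub> (const (u [^] k) \<otimes>\<^bsub>P\<^esub> g) = g"
    and "const (u [^] (k::nat)) \<otimes>\<^bsub>P\<^esub> (const (inv u [^] k) \<otimes>\<^bsub>P\<^esub> g) = g"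
proof -
  have u: "u \<in> carrier R" "inv u \<in> carrier R" using assms by auto
  have 1: "inv u [^] k \<otimes> u [^] k = \<one>"
    using u assms nat_pow_distrib[of "inv u" u k] by (simp add: Units_l_inv)
  show "const (inv u [^] k) \<otimes>\<^bsub>P\<^esub> (const (u [^] k) \<otimes>\<^bsub>P\<^esub> g) = g"
    using u assms 1 by (simp flip: P.m_assoc const_mult) (simp flip: one_P)
  show "const (u [^] k) \<otimes>\<^bsub>P\<^esub> (const (inv u [^] k) \<otimes>\<^bsub>P\<^esub> g) = g"
    using u assms 1 by (simp flip: P.m_assoc const_mult add: m_comm[of "u [^] k"]) (simp flip: one_P)
qed

text \<open>A formal inverse function theorem.  By \<open>scalar_leading_term\<close> the map is multiplication by the unit
  \<open>u\<^sup>k\<close> on each graded piece; so it has no kernel, and preimages are found by successive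
  approximation.\<close>
lemma scalar_linear_part_bij:
  assumes \<phi>: "\<phi> \<in> aug_endo" and u: "u \<in> Units R" and lin: "scalar_linear_part u \<phi>"
  shows "bij_betw \<phi> (carrier P) (carrier P)"
proof (rule bij_betw_imageI)
  have uc: "u \<in> carrier R" "inv u \<in> carrier R" using u by auto
  note lead = scalar_leading_term[OF \<phi> uc(1) lin]
  show "inj_on \<phi> (carrier P)"
  proof (rule inj_onI)
    fix f g assume f: "f \<in> carrier P" and g: "g \<in> carrier P" and eq: "\<phi> f = \<phi> g"
    define d where "d = f \<ominus>\<^bsub>P\<^esub> g"
    have dP: "d \<in> carrier P" and \<phi>d: "\<phi> d = \<zero>\<^bsub>P\<^esub>"
      using f g eq \<phi> by (simp_all add: d_def aug_endo_minus)
    have "d \<in> \<F> k" for k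
    proof (induction k)
      case 0
      then show ?case using dP by (simp add: F_0)
    next
      case (Suc k)
      from lead[OF Suc] have "agree (Suc k) \<zero>\<^bsub>P\<^esub> (const (u [^] k) \<otimes>\<^bsub>P\<^esub> d)"
        by (simp add: \<phi>d)
      then have "const (u [^] k) \<otimes>\<^bsub>P\<^esub> d \<in> \<F> (Suc k)"
        using dP uc by (auto intro: agree_F agree_sym)
      then have "const (inv u [^] k) \<otimes>\<^bsub>P\<^esub> (const (u [^] k) \<otimes>\<^bsub>P\<^esub> d) \<in> \<F> (Suc k)"
        by (rule F_mult_left[rotated]) (use uc in simp)
      then show ?case using u dP by (simp add: const_unit_cancel)
    qed
    then have "d = \<zero>\<^bsub>P\<^esub>" by (rule F_Inter)
    then show "f = g" using f g by (simp add: d_def)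
  qed
  show "\<phi> ` carrier P = carrier P"
  proof (intro equalityI subsetI)
    fix t assume t: "t \<in> carrier P"
    (* An error d of order N is removed up to order N + 1 by adding u^(-N) d to the approximation. *)
    define s where "s = rec_nat \<zero>\<^bsub>P\<^esub>
      (\<lambda>N y. y \<oplus>\<^bsub>P\<^esub> const (inv u [^] N) \<otimes>\<^bsub>P\<^esub> (t \<ominus>\<^bsub>P\<^esub> \<phi> y))"
    have s0: "s 0 = \<zero>\<^bsub>P\<^esub>"
      and sSuc: "s (Suc N) = s N \<oplus>\<^bsub>P\<^esub> const (inv u [^] N) \<otimes>\<^bsub>P\<^esub> (t \<ominus>\<^bsub>P\<^esub> \<phi> (s N))" for N
      by (simp_all add: s_def)
    have sP: "s N \<in> carrier P" for N
      by (induction N) (use t \<phi> uc in \<open>simp_all add: s0 sSuc\<close>)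
    have approx: "t \<ominus>\<^bsub>P\<^esub> \<phi> (s N) \<in> \<F> N" for N
    proof (induction N)
      case 0
      then show ?case using t \<phi> sP by (simp add: F_0)
    next
      case (Suc N)
      define d where "d = t \<ominus>\<^bsub>P\<^esub> \<phi> (s N)"
      have d: "d \<in> \<F> N" using Suc by (simp add: d_def)
      note dP = F_carrier[OF d]
      have "agree (Suc N) (\<phi> (const (inv u [^] N) \<otimes>\<^bsub>P\<^esub> d)) d"
        using lead[of "const (inv u [^] N) \<otimes>\<^bsub>P\<^esub> d" N] d dP u uc
        by (simp add: F_mult_left const_unit_cancel)
      then have "agree (Suc N) (\<phi> (s N) \<oplus>\<^bsub>P\<^esub> \<phi> (const (inv u [^] N) \<otimes>\<^bsub>P\<^esub> d)) (\<phi> (s N) \<oplus>\<^bsub>P\<^esub> d)"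
        by (simp add: agree_add)
      moreover have "\<phi> (s N) \<oplus>\<^bsub>P\<^esub> d = t"
        using t \<phi> sP by (simp add: d_def a_minus_def P.a_lcomm P.r_neg)
      ultimately have "agree (Suc N) (\<phi> (s (Suc N))) t"
        using \<phi> sP dP uc by (simp add: sSuc aug_endo_add flip: d_def)
      then show ?case
        using t \<phi> sP by (simp add: agree_sym flip: agree_iff_minus)
    qed
    have step: "agree N (s (Suc N)) (s N)" for N
    proof -
      have "const (inv u [^] N) \<otimes>\<^bsub>P\<^esub> (t \<ominus>\<^bsub>P\<^esub> \<phi> (s N)) \<in> \<F> N"
        using approx uc by (simp add: F_mult_left)
      then show ?thesis
        using sP by (auto simp: sSuc agree_def vanishing_below_def coeff_simps)
    qed
    have y: "limit s \<in> carrier P" using sP by (rule limit_closed)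
    have "agree N (\<phi> (limit s)) t" for N
    proof -
      have "agree N (\<phi> (limit s)) (\<phi> (s N))"
        by (rule aug_endo_agree[OF \<phi> y sP agree_limit[of s, OF step]])
      also have "agree N (\<phi> (s N)) t"
        using approx[of N] t \<phi> sP by (simp add: agree_sym flip: agree_iff_minus)
      finally show ?thesis .
    qed
    then have "\<phi> (limit s) = t" by (rule agree_eqI)
    then show "t \<in> \<phi> ` carrier P" using y by blast
  qed (use \<phi> in auto)
qed

end

section \<open>Substitution\<close>

context power_series
begin

definition monomials :: "nat \<Rightarrow> nat multiset set"
  where "monomials d = {k. set_mset k \<subseteq> {1..n} \<and> size k \<le> d}"

lemma finite_monomials [simp]: "finite (monomials d)"
proof (rule finite_subset)
  show "monomials d \<subseteq> (\<Union>j\<le>d. multisets_of_size {1..n} j)"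
    by (auto simp: monomials_def multisets_of_size_def)
qed auto

definition monomial_value :: "(nat \<Rightarrow> nat multiset \<Rightarrow> 'a) \<Rightarrow> nat multiset \<Rightarrow> nat multiset \<Rightarrow> 'a"
  where "monomial_value h k = (\<Otimes>\<^bsub>P\<^esub>i\<in>{1..n}. h i [^]\<^bsub>P\<^esub> count k i)"

text \<open>If the series \<open>h i\<close> have no constant term, a monomial \<open>k\<close> takes a value of order at least \<open>size k\<close>.  Hence
  only monomials of degree at most \<open>size m\<close> contribute to the coefficient at \<open>m\<close>, and the sum is
  finite.\<close>
definition subst :: "(nat \<Rightarrow> nat multiset \<Rightarrow> 'a) \<Rightarrow> (nat multiset \<Rightarrow> 'a) \<Rightarrow> nat multiset \<Rightarrow> 'a"
  where "subst h g = (\<lambda>m. \<Oplus>k\<in>monomials (size m). g k \<otimes> monomial_value h k m)"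

context
  fixes h :: "nat \<Rightarrow> nat multiset \<Rightarrow> 'a"
  assumes h: "\<And>i. i \<in> {1..n} \<Longrightarrow> h i \<in> \<F> 1"
begin

lemma values_closed: "i \<in> {1..n} \<Longrightarrow> h i \<in> carrier P"
  using h by (rule F_carrier)

lemma monomial_value_closed: "monomial_value h k \<in> carrier P"
  unfolding monomial_value_def by (rule P.finprod_closed) (auto intro!: P.nat_pow_closed values_closed)

lemma monomial_value_empty: "monomial_value h {#} = \<one>\<^bsub>P\<^esub>"
  unfolding monomial_value_def by (rule P.finprod_one_eqI) simp

lemma monomial_value_add:
  assumes i: "i \<in> {1..n}"
  shows "monomial_value h (add_mset i k) = h i \<otimes>\<^bsub>P\<^esub> monomial_value h k"
proof -
  define A where "A = {1..n} - {i}"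
  have A: "{1..n} = insert i A" "finite A" "i \<notin> A" using i by (auto simp: A_def)
  have c: "h j [^]\<^bsub>P\<^esub> (c :: nat) \<in> carrier P" if "j \<in> insert i A" for j c
    using that A(1) values_closed by (intro P.nat_pow_closed) simp
  have split: "monomial_value h k = h i [^]\<^bsub>P\<^esub> count k i \<otimes>\<^bsub>P\<^esub> (\<Otimes>\<^bsub>P\<^esub>j\<in>A. h j [^]\<^bsub>P\<^esub> count k j)" for k
    unfolding monomial_value_def A(1) by (rule P.finprod_insert) (use A c in auto)
  have "(\<Otimes>\<^bsub>P\<^esub>j\<in>A. h j [^]\<^bsub>P\<^esub> count (add_mset i k) j) = (\<Otimes>\<^bsub>P\<^esub>j\<in>A. h j [^]\<^bsub>P\<^esub> count k j)"
    by (rule P.finprod_cong') (use A c in auto)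
  moreover have "(\<Otimes>\<^bsub>P\<^esub>j\<in>A. h j [^]\<^bsub>P\<^esub> count k j) \<in> carrier P"
    by (rule P.finprod_closed) (use c in auto)
  ultimately show ?thesis
    unfolding split[of "add_mset i k"] split[of k]
    using c[of i "count k i"] values_closed[OF i] by (simp add: P.m_ac)
qed

lemma monomial_value_F: "set_mset k \<subseteq> {1..n} \<Longrightarrow> monomial_value h k \<in> \<F> (size k)"
proof (induction k)
  case empty
  show ?case by (simp add: F_0 monomial_value_closed)
next
  case (add i k)
  then have "h i \<otimes>\<^bsub>P\<^esub> monomial_value h k \<in> \<F> (1 + size k)"
    by (intro F_mult h) auto
  then show ?case using add.prems by (simp add: monomial_value_add)
qed

lemma summand_closed: "g \<in> carrier P \<Longrightarrow> g k \<otimes> monomial_value h k m \<in> carrier R"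
  by (intro m_closed coeff_closed monomial_value_closed)

text \<open>Allowing a larger degree bound makes the coefficients at \<open>m\<close> and at its submultisets sums over
  the same index set.\<close>
lemma subst_eq:
  assumes g: "g \<in> carrier P" and m: "size m \<le> d"
  shows "subst h g m = (\<Oplus>k\<in>monomials d. g k \<otimes> monomial_value h k m)"
  unfolding subst_def
proof (rule add.finprod_mono_neutral_cong_left)
  fix k assume "k \<in> monomials d - monomials (size m)"
  then have "set_mset k \<subseteq> {1..n}" "size m < size k" by (auto simp: monomials_def)
  then have "monomial_value h k m = \<zero>"
    using monomial_value_F[of k] by (simp add: vanishing_below_def)
  then show "g k \<otimes> monomial_value h k m = \<zero>" using g by simp
next
  show "monomials (size m) \<subseteq> monomials d" using m by (auto simp: monomials_def)
qed (use summand_closed[OF g] in auto)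

lemma subst_coeff_closed: "g \<in> carrier P \<Longrightarrow> subst h g m \<in> carrier R"
  unfolding subst_def by (intro finsum_closed Pi_I summand_closed)

lemma subst_closed:
  assumes g: "g \<in> carrier P"
  shows "subst h g \<in> carrier P"
proof (rule carrier_PI)
  show "subst h g m \<in> carrier R" for m using g by (rule subst_coeff_closed)
  show "subst h g m = \<zero>" if "\<not> set_mset m \<subseteq> {1..n}" for m
    unfolding subst_def using coeff_outside[OF monomial_value_closed that] g
    by (intro add.finprod_one_eqI) simp
qed

lemma subst_F:
  assumes g: "g \<in> \<F> j"
  shows "subst h g \<in> \<F> j"
proof -
  have "subst h g m = \<zero>" if m: "size m < j" for m
    unfolding subst_def
  proof (rule add.finprod_one_eqI)
    fix k assume "k \<in> monomials (size m)"
    then have "g k = \<zero>" using g m by (auto simp: monomials_def vanishing_below_def)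
    then show "g k \<otimes> monomial_value h k m = \<zero>"
      using coeff_closed[OF monomial_value_closed] by simp
  qed
  then show ?thesis
    using subst_closed[OF F_carrier[OF g]] by (simp add: vanishing_below_def)
qed

lemma subst_add:
  assumes f: "f \<in> carrier P" and g: "g \<in> carrier P"
  shows "subst h (f \<oplus>\<^bsub>P\<^esub> g) = subst h f \<oplus>\<^bsub>P\<^esub> subst h g"
proof
  fix m :: "nat multiset"
  have "subst h (f \<oplus>\<^bsub>P\<^esub> g) m = (\<Oplus>k\<in>monomials (size m).
      f k \<otimes> monomial_value h k m \<oplus> g k \<otimes> monomial_value h k m)"
    unfolding subst_def
    by (rule finsum_cong')
      (use f g coeff_closed[OF monomial_value_closed] in \<open>auto simp: coeff_add l_distr\<close>)
  also have "\<dots> = (subst h f \<oplus>\<^bsub>P\<^esub> subst h g) m"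
    unfolding coeff_add subst_def
    by (rule finsum_addf) (use summand_closed f g in auto)
  finally show "subst h (f \<oplus>\<^bsub>P\<^esub> g) m = (subst h f \<oplus>\<^bsub>P\<^esub> subst h g) m" .
qed

lemma subst_const_mult:
  assumes r: "r \<in> carrier R" and g: "g \<in> carrier P"
  shows "subst h (const r \<otimes>\<^bsub>P\<^esub> g) = const r \<otimes>\<^bsub>P\<^esub> subst h g"
proof
  fix m :: "nat multiset"
  have "subst h (const r \<otimes>\<^bsub>P\<^esub> g) m
      = (\<Oplus>k\<in>monomials (size m). r \<otimes> (g k \<otimes> monomial_value h k m))"
    unfolding subst_def
    by (rule finsum_cong')
      (use r g coeff_closed[OF monomial_value_closed] in \<open>auto simp: coeff_const_mult m_assoc\<close>)
  also have "\<dots> = r \<otimes> subst h g m"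
    unfolding subst_def
    by (rule finsum_rdistr[symmetric]) (use r summand_closed[OF g] in auto)
  also have "\<dots> = (const r \<otimes>\<^bsub>P\<^esub> subst h g) m"
    using r subst_closed[OF g] by (simp add: coeff_const_mult)
  finally show "subst h (const r \<otimes>\<^bsub>P\<^esub> g) m = (const r \<otimes>\<^bsub>P\<^esub> subst h g) m" .
qed

lemma subst_one: "subst h \<one>\<^bsub>P\<^esub> = \<one>\<^bsub>P\<^esub>"
proof
  fix m :: "nat multiset"
  have "{#} \<in> monomials (size m)" by (simp add: monomials_def)
  then have "subst h \<one>\<^bsub>P\<^esub> m = (\<Oplus>k\<in>{{#}}. monomial_value h k m)"
    unfolding subst_def one_P
    by (intro add.finprod_mono_neutral_cong_right)
      (use coeff_closed[OF monomial_value_closed] in \<open>auto simp: indexed_const_def\<close>)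
  then show "subst h \<one>\<^bsub>P\<^esub> m = \<one>\<^bsub>P\<^esub> m"
    using coeff_closed[OF P.one_closed] by (simp add: monomial_value_empty)
qed

lemma subst_const:
  assumes r: "r \<in> carrier R"
  shows "subst h (const r) = const r"
  using subst_const_mult[OF r P.one_closed] r by (simp add: subst_one)

text \<open>Multiplication by \<open>X\<^sub>i\<close> shifts the monomial \<open>k\<close> to \<open>add_mset i k\<close>, whose value is \<open>h i\<close> times that of \<open>k\<close>;
  exchanging the sum over \<open>k\<close> with the one in the product of series gives the claim.\<close>
lemma subst_var_mult:
  assumes i: "i \<in> {1..n}" and g: "g \<in> carrier P"
  shows "subst h (var i \<otimes>\<^bsub>P\<^esub> g) = h i \<otimes>\<^bsub>P\<^esub> subst h g"
proof
  fix m :: "nat multiset"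
  define K where "K = monomials (size m)"
  have K: "finite K" by (simp add: K_def)
  define S where "S = {p. p \<subseteq># m}"
  have S: "finite S" unfolding S_def by (rule finite_submultisets)
  have H: "monomial_value h k p \<in> carrier R" for k p
    by (intro coeff_closed monomial_value_closed)
  have hi: "h i p \<in> carrier R" for p
    by (intro coeff_closed values_closed i)
  have gk: "g k \<in> carrier R" for k using g by simp
  have vP: "var i \<otimes>\<^bsub>P\<^esub> g \<in> carrier P" using i g by simp
  have "subst h (var i \<otimes>\<^bsub>P\<^esub> g) m
      = (\<Oplus>k\<in>monomials (Suc (size m)). (var i \<otimes>\<^bsub>P\<^esub> g) k \<otimes> monomial_value h k m)"
    by (rule subst_eq[OF vP]) simp
  also have "\<dots> = (\<Oplus>k\<in>add_mset i ` K. (var i \<otimes>\<^bsub>P\<^esub> g) k \<otimes> monomial_value h k m)"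
  proof (rule add.finprod_mono_neutral_cong_right)
    show "add_mset i ` K \<subseteq> monomials (Suc (size m))"
      using i by (auto simp: K_def monomials_def)
    fix k assume k: "k \<in> monomials (Suc (size m)) - add_mset i ` K"
    have "i \<notin># k"
    proof
      assume "i \<in># k"
      then obtain k' where "k = add_mset i k'" by (metis multi_member_split)
      with k show False by (auto simp: K_def monomials_def)
    qed
    then show "(var i \<otimes>\<^bsub>P\<^esub> g) k \<otimes> monomial_value h k m = \<zero>"
      using i g H by (simp add: coeff_var_mult)
  qed (use summand_closed[OF vP] in auto)
  also have "\<dots> = (\<Oplus>k\<in>K. (var i \<otimes>\<^bsub>P\<^esub> g) (add_mset i k) \<otimes> monomial_value h (add_mset i k) m)"
    by (rule finsum_reindex) (use summand_closed[OF vP] in \<open>auto simp: inj_on_def\<close>)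
  also have "\<dots> = (\<Oplus>k\<in>K. \<Oplus>p\<in>S. h i p \<otimes> (g k \<otimes> monomial_value h k (m - p)))"
  proof (rule finsum_cong')
    fix k assume "k \<in> K"
    have "(var i \<otimes>\<^bsub>P\<^esub> g) (add_mset i k) \<otimes> monomial_value h (add_mset i k) m
        = g k \<otimes> (\<Oplus>p\<in>S. h i p \<otimes> monomial_value h k (m - p))"
      unfolding monomial_value_add[OF i] coeff_var_mult[OF i g] by (simp add: mult_P S_def)
    also have "\<dots> = (\<Oplus>p\<in>S. g k \<otimes> (h i p \<otimes> monomial_value h k (m - p)))"
      by (rule finsum_rdistr) (use S gk hi H in auto)
    also have "\<dots> = (\<Oplus>p\<in>S. h i p \<otimes> (g k \<otimes> monomial_value h k (m - p)))"
      by (rule finsum_cong') (use gk hi H m_lcomm in auto)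
    finally show "(var i \<otimes>\<^bsub>P\<^esub> g) (add_mset i k) \<otimes> monomial_value h (add_mset i k) m
        = (\<Oplus>p\<in>S. h i p \<otimes> (g k \<otimes> monomial_value h k (m - p)))" .
  qed (use gk hi H in \<open>auto intro!: finsum_closed\<close>)
  also have "\<dots> = (\<Oplus>p\<in>S. \<Oplus>k\<in>K. h i p \<otimes> (g k \<otimes> monomial_value h k (m - p)))"
    by (rule finsum_finsum_swap) (use K S gk hi H in auto)
  also have "\<dots> = (\<Oplus>p\<in>S. h i p \<otimes> subst h g (m - p))"
  proof (rule finsum_cong')
    fix p assume "p \<in> S"
    then have "size (m - p) \<le> size m" by (simp add: size_mset_mono)
    then have "subst h g (m - p) = (\<Oplus>k\<in>K. g k \<otimes> monomial_value h k (m - p))"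
      unfolding K_def by (rule subst_eq[OF g])
    then show "(\<Oplus>k\<in>K. h i p \<otimes> (g k \<otimes> monomial_value h k (m - p))) = h i p \<otimes> subst h g (m - p)"
      using finsum_rdistr[OF K hi, of "\<lambda>k. g k \<otimes> monomial_value h k (m - p)" p] gk H by simp
  qed (use hi subst_coeff_closed[OF g] in auto)
  also have "\<dots> = (h i \<otimes>\<^bsub>P\<^esub> subst h g) m"
    by (simp add: mult_P S_def)
  finally show "subst h (var i \<otimes>\<^bsub>P\<^esub> g) m = (h i \<otimes>\<^bsub>P\<^esub> subst h g) m" .
qed

text \<open>Instead of multiplying out both values, the two sides are compared modulo \<open>\<F> j\<close> by induction on \<open>j\<close>.
  For a constant \<open>f\<close> they are equal by linearity, and a factor \<open>X\<^sub>i\<close> of \<open>f\<close> can be moved out of both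
  sides as \<open>h i\<close>, which has order 1 and improves the congruence by one degree.\<close>
lemma subst_mult:
  assumes f: "f \<in> carrier P" and g: "g \<in> carrier P"
  shows "subst h (f \<otimes>\<^bsub>P\<^esub> g) = subst h f \<otimes>\<^bsub>P\<^esub> subst h g"
proof (rule agree_eqI)
  fix j
  show "agree j (subst h (f \<otimes>\<^bsub>P\<^esub> g)) (subst h f \<otimes>\<^bsub>P\<^esub> subst h g)"
    using f
  proof (induction j arbitrary: f)
    case 0
    show ?case by simp
  next
    case (Suc j)
    have d: "agree (Suc j) (subst h (d \<otimes>\<^bsub>P\<^esub> g)) (subst h d \<otimes>\<^bsub>P\<^esub> subst h g)"
      if "d \<in> \<F> 1" for d
      using that[unfolded One_nat_def]
    proof (induction rule: F_Suc_induct)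
      case zero
      have "subst h \<zero>\<^bsub>P\<^esub> = \<zero>\<^bsub>P\<^esub>"
        using F_Inter subst_F[OF F_zero] by blast
      then show ?case using g subst_closed[OF g] by simp
    next
      case (add d d')
      then show ?case
        using g by (simp add: P.l_distr subst_add subst_closed agree_add)
    next
      case (var_mult i f)
      have fP: "f \<in> carrier P" using var_mult F_carrier by blast
      have "agree (1 + j) (h i \<otimes>\<^bsub>P\<^esub> subst h (f \<otimes>\<^bsub>P\<^esub> g)) (h i \<otimes>\<^bsub>P\<^esub> (subst h f \<otimes>\<^bsub>P\<^esub> subst h g))"
        by (rule agree_F_mult) (use Suc.IH[OF fP] fP g subst_closed h var_mult in auto)
      then show ?case
        using var_mult(1) fP g
        by (simp add: P.m_assoc subst_var_mult subst_closed values_closed)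
    qed
    obtain d where d1: "d \<in> \<F> 1" and fd: "f = const (f {#}) \<oplus>\<^bsub>P\<^esub> d"
      using const_decomp[OF Suc.prems] .
    have r: "f {#} \<in> carrier R" and dP: "d \<in> carrier P"
      using Suc.prems d1 F_carrier by auto
    have "subst h (f \<otimes>\<^bsub>P\<^esub> g) = const (f {#}) \<otimes>\<^bsub>P\<^esub> subst h g \<oplus>\<^bsub>P\<^esub> subst h (d \<otimes>\<^bsub>P\<^esub> g)"
      using g dP r by (subst fd) (simp add: P.l_distr subst_add subst_const_mult)
    moreover have "subst h f \<otimes>\<^bsub>P\<^esub> subst h g
        = const (f {#}) \<otimes>\<^bsub>P\<^esub> subst h g \<oplus>\<^bsub>P\<^esub> subst h d \<otimes>\<^bsub>P\<^esub> subst h g"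
      using g dP r by (subst fd) (simp add: P.l_distr subst_add subst_const subst_closed)
    ultimately show ?case
      using d[OF d1] by (simp add: agree_add)
  qed
qed

lemma subst_aug_endo: "subst h \<in> aug_endo"
  unfolding aug_endo_def
proof (intro CollectI conjI ballI)
  show "subst h \<in> ring_hom P P"
    by (rule ring_hom_memI) (simp_all add: subst_closed subst_mult subst_add subst_one)
qed (auto simp: subst_const intro: subst_F)

lemma subst_var: "i \<in> {1..n} \<Longrightarrow> subst h (var i) = h i"
  using subst_var_mult[of i "\<one>\<^bsub>P\<^esub>"] by (simp add: subst_one values_closed)

end

end

section \<open>The adic topology and the groups of automorphisms\<close>

context power_series
begin

lemma F_ideal: "ideal (\<F> k) P"
proof (rule idealI)
  show "ring P" by (rule P.ring_axioms)
  show "subgroup (\<F> k) (add_monoid P)"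
  proof (rule group.subgroupI)
    show "group (add_monoid P)" by (rule P.a_group)
    show "\<F> k \<noteq> {}" using F_zero by blast
    show "inv\<^bsub>add_monoid P\<^esub> a \<in> \<F> k" if "a \<in> \<F> k" for a
      using F_uminus[OF that] by (simp add: a_inv_def)
  qed (auto simp: F_carrier F_add)
qed (auto intro: F_mult_left F_mult_right)

lemma var_ideal_eq: "var_ideal R n = \<F> 1"
  unfolding var_ideal_def
proof (rule equalityI)
  show "Idl\<^bsub>P\<^esub> (var ` {1..n}) \<subseteq> \<F> 1"
    by (rule P.genideal_minimal[OF F_ideal]) (use var_F in blast)
  have vars: "var ` {1..n} \<subseteq> carrier P"
    using var_closed by blast
  interpret M: ideal "Idl\<^bsub>P\<^esub> (var ` {1..n})" P
    by (rule P.genideal_ideal[OF vars])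
  show "\<F> 1 \<subseteq> Idl\<^bsub>P\<^esub> (var ` {1..n})"
  proof
    fix f assume "f \<in> \<F> 1"
    then have "f \<in> \<F> (Suc 0)" by simp
    then show "f \<in> Idl\<^bsub>P\<^esub> (var ` {1..n})"
    proof (induction rule: F_Suc_induct)
      case zero
      show ?case by (rule M.zero_closed)
    next
      case (add f g)
      then show ?case by (intro M.a_closed)
    next
      case (var_mult i h)
      then show ?case
        using P.genideal_self[OF vars] by (intro M.I_r_closed) (auto simp: F_0)
    qed
  qed
qed

lemma F_Suc_eq: "ideal_prod P (\<F> k) (\<F> 1) = \<F> (Suc k)"
proof (intro equalityI subsetI)
  fix f assume "f \<in> ideal_prod P (\<F> k) (\<F> 1)"
  then show "f \<in> \<F> (Suc k)"
  proof induction
    case (prod i j)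
    then show ?case using F_mult[of i k j 1] by simp
  qed (rule F_add)
next
  fix f assume "f \<in> \<F> (Suc k)"
  then show "f \<in> ideal_prod P (\<F> k) (\<F> 1)"
  proof (induction rule: F_Suc_induct)
    case zero
    show ?case
      using ideal_prod.prod[OF F_zero F_zero, of P k 1] by simp
  next
    case (add f g)
    then show ?case by (intro ideal_prod.sum)
  next
    case (var_mult i h)
    have "h \<otimes>\<^bsub>P\<^esub> var i \<in> ideal_prod P (\<F> k) (\<F> 1)"
      by (rule ideal_prod.prod[OF var_mult(2) var_F[OF var_mult(1)]])
    then show ?case
      using P.m_comm[OF F_carrier[OF var_mult(2)] var_closed[OF var_mult(1)]] by simp
  qed
qed

lemma ideal_power_eq: "ideal_power P (\<F> 1) k = \<F> k"
proof (induction k)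
  case 0
  show ?case by (simp add: ideal_power_def F_0) (simp add: ideals_set_def)
next
  case (Suc k)
  have "ideal_power P (\<F> 1) (Suc k) = ideal_prod P (ideal_power P (\<F> 1) k) (\<F> 1)"
    by (simp add: ideal_power_def) (simp add: ideals_set_def)
  then show ?case by (simp only: Suc F_Suc_eq)
qed

lemma F_coset_iff:
  assumes f: "f \<in> carrier P"
  shows "g \<in> \<F> k +>\<^bsub>P\<^esub> f \<longleftrightarrow> g \<in> carrier P \<and> agree k g f"
proof
  assume "g \<in> \<F> k +>\<^bsub>P\<^esub> f"
  then obtain d where d: "d \<in> \<F> k" and g: "g = d \<oplus>\<^bsub>P\<^esub> f"
    by (auto simp: a_r_coset_def')
  then show "g \<in> carrier P \<and> agree k g f"
    using f F_carrier[OF d] by (auto simp: agree_def coeff_add vanishing_below_def)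
next
  assume g: "g \<in> carrier P \<and> agree k g f"
  then have "g \<ominus>\<^bsub>P\<^esub> f \<in> \<F> k" using f by (simp flip: agree_iff_minus)
  moreover have "g = (g \<ominus>\<^bsub>P\<^esub> f) \<oplus>\<^bsub>P\<^esub> f"
    using f g by (simp add: P.minus_eq P.a_assoc P.l_neg)
  ultimately show "g \<in> \<F> k +>\<^bsub>P\<^esub> f"
    unfolding a_r_coset_def' by blast
qed

text \<open>The map respects congruence modulo \<open>\<F> k\<close>, so the preimage of a coset of \<open>\<F> k\<close> is a union of cosets of
  \<open>\<F> k\<close>.\<close>
lemma aug_endo_continuous:
  assumes \<phi>: "\<phi> \<in> aug_endo"
  shows "continuous_map (adic_topology P (\<F> 1)) (adic_topology P (\<F> 1)) \<phi>"
proof -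
  define B where "B = {\<F> k +>\<^bsub>P\<^esub> f | k f. f \<in> carrier P}"
  have T: "adic_topology P (\<F> 1) = topology_generated_by B"
    unfolding adic_topology_def B_def ideal_power_eq ..
  have self: "f \<in> \<F> k +>\<^bsub>P\<^esub> f" if "f \<in> carrier P" for f k
    using that by (simp add: F_coset_iff)
  have UB: "\<Union> B = carrier P"
  proof (intro equalityI subsetI)
    fix g assume g: "g \<in> carrier P"
    then have "\<F> 0 +>\<^bsub>P\<^esub> g \<in> B" unfolding B_def by blast
    then show "g \<in> \<Union> B" using self[OF g] by blast
  qed (auto simp: B_def F_coset_iff)
  show ?thesis
    unfolding T
  proof (rule continuous_on_generated_topo)
    show "\<phi> ` topspace (topology_generated_by B) \<subseteq> \<Union> B"
      using \<phi> by (auto simp: UB)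
    fix U assume "U \<in> B"
    then obtain k f where f: "f \<in> carrier P" and U: "U = \<F> k +>\<^bsub>P\<^esub> f"
      by (auto simp: B_def)
    have "\<phi> -` U \<inter> carrier P = \<Union> {\<F> k +>\<^bsub>P\<^esub> g | g. g \<in> carrier P \<and> \<phi> g \<in> U}"
    proof (intro equalityI subsetI)
      fix g assume "g \<in> \<phi> -` U \<inter> carrier P"
      then show "g \<in> \<Union> {\<F> k +>\<^bsub>P\<^esub> g | g. g \<in> carrier P \<and> \<phi> g \<in> U}"
        using self by blast
    next
      fix g assume "g \<in> \<Union> {\<F> k +>\<^bsub>P\<^esub> g | g. g \<in> carrier P \<and> \<phi> g \<in> U}"
      then obtain g' where g': "g' \<in> carrier P" "\<phi> g' \<in> U" "g \<in> \<F> k +>\<^bsub>P\<^esub> g'"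
        by blast
      then have g: "g \<in> carrier P" "agree k g g'" by (simp_all add: F_coset_iff)
      have "agree k (\<phi> g) (\<phi> g')"
        by (rule aug_endo_agree[OF \<phi>]) (use g g' in auto)
      moreover have "agree k (\<phi> g') f"
        using g' f by (simp add: U F_coset_iff)
      ultimately have "\<phi> g \<in> U"
        using \<phi> g f by (auto simp: U F_coset_iff intro: agree_trans)
      then show "g \<in> \<phi> -` U \<inter> carrier P" using g by simp
    qed
    moreover have "openin (topology_generated_by B) (\<Union> {\<F> k +>\<^bsub>P\<^esub> g | g. g \<in> carrier P \<and> \<phi> g \<in> U})"
      by (rule openin_Union) (auto intro!: topology_generated_by_Basis simp: B_def)
    ultimately show "openin (topology_generated_by B) (\<phi> -` U \<inter> topspace (topology_generated_by B))"
      by (simp add: UB)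
  qed
qed

lemma carrier_GAc: "carrier (GAc R n) = aug_endo \<inter> Bij (carrier P)"
  using aug_endo_continuous
  by (auto simp: GAc_def Let_def ring_aut_group_def var_ideal_eq aug_endo_def)

lemma GAc_eq: "GAc R n = BijGroup (carrier P) \<lparr>carrier := aug_endo \<inter> Bij (carrier P)\<rparr>"
proof -
  have "GAc R n = BijGroup (carrier P) \<lparr>carrier := carrier (GAc R n)\<rparr>"
    by (simp add: GAc_def Let_def ring_aut_group_def)
  then show ?thesis by (simp only: carrier_GAc)
qed

lemma aug_endo_cong:
  assumes "\<phi> \<in> aug_endo" "\<And>f. f \<in> carrier P \<Longrightarrow> \<psi> f = \<phi> f"
  shows "\<psi> \<in> aug_endo"
proof -
  have "\<psi> \<in> ring_hom P P"
    by (rule ring_hom_memI) (use assms ring_hom_one[of \<phi> P P] in \<open>simp_all add: aug_endo_add aug_endo_mult aug_endo_def\<close>)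
  then show ?thesis
    using assms F_carrier by (simp add: aug_endo_def image_subset_iff)
qed

lemma aug_endo_restrict: "\<phi> \<in> aug_endo \<Longrightarrow> restrict \<phi> (carrier P) \<in> aug_endo"
  by (rule aug_endo_cong) auto

text \<open>The inverse is augmented as well: if the preimage of \<open>f\<close> has constant term \<open>r\<close>, then so does \<open>f\<close>, because
  the map fixes constants and preserves series without constant term.\<close>
lemma aug_endo_inv:
  assumes \<phi>: "\<phi> \<in> aug_endo" and bij: "\<phi> \<in> Bij (carrier P)"
  shows "restrict (inv_into (carrier P) \<phi>) (carrier P) \<in> aug_endo"
proof (rule aug_endo_restrict)
  define \<psi> where "\<psi> = inv_into (carrier P) \<phi>"
  have b: "bij_betw \<phi> (carrier P) (carrier P)" using bij by (simp add: Bij_def)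
  have \<psi>P: "\<psi> f \<in> carrier P" and \<phi>\<psi>: "\<phi> (\<psi> f) = f" if "f \<in> carrier P" for f
    using that b unfolding \<psi>_def by (auto simp: bij_betw_def inv_into_into f_inv_into_f)
  have \<psi>\<phi>: "\<psi> f = g" if "g \<in> carrier P" "\<phi> g = f" for f g
    using that b unfolding \<psi>_def by (auto simp: bij_betw_def inv_into_f_f)
  have "\<psi> \<in> ring_hom P P"
    by (rule ring_hom_memI; (rule \<psi>\<phi>)?)
      (use \<phi> ring_hom_one[of \<phi> P P] in \<open>simp_all add: \<psi>P \<phi>\<psi> aug_endo_add aug_endo_mult aug_endo_def\<close>)
  moreover have "\<psi> (const r) = const r" if "r \<in> carrier R" for r
    by (rule \<psi>\<phi>) (use \<phi> that in \<open>simp_all add: aug_endo_const\<close>)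
  moreover have "\<psi> f \<in> \<F> 1" if f: "f \<in> \<F> 1" for f
  proof -
    have fP: "f \<in> carrier P" using f by (rule F_carrier)
    define r where "r = \<psi> f {#}"
    have r: "r \<in> carrier R" using \<psi>P[OF fP] by (simp add: r_def)
    obtain d where d: "d \<in> \<F> 1" and \<psi>f: "\<psi> f = const r \<oplus>\<^bsub>P\<^esub> d"
      using const_decomp[OF \<psi>P[OF fP]] unfolding r_def .
    have "f = const r \<oplus>\<^bsub>P\<^esub> \<phi> d"
      using \<phi>\<psi>[OF fP] r F_carrier[OF d] \<phi> by (simp add: \<psi>f aug_endo_add aug_endo_const)
    then have "f {#} = r"
      using aug_endo_F1[OF \<phi> d] r by (simp add: coeff_add vanishing_below_def indexed_const_def)
    then have "r = \<zero>" using f by (simp add: vanishing_below_def)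
    then show ?thesis
      using \<psi>P[OF fP] by (auto simp: r_def vanishing_below_def)
  qed
  ultimately show "inv_into (carrier P) \<phi> \<in> aug_endo"
    by (auto simp: aug_endo_def \<psi>_def)
qed

lemma group_GAc: "group (GAc R n)"
  unfolding GAc_eq
proof (rule subgroup.subgroup_is_group[OF _ group_BijGroup])
  show "subgroup (aug_endo \<inter> Bij (carrier P)) (BijGroup (carrier P))"
  proof (rule subgroup.intro)
    fix \<phi> \<psi> assume *: "\<phi> \<in> aug_endo \<inter> Bij (carrier P)" "\<psi> \<in> aug_endo \<inter> Bij (carrier P)"
    then have "compose (carrier P) \<phi> \<psi> \<in> aug_endo"
      using aug_endo_restrict[OF aug_endo_comp[of \<phi> \<psi>]]
      by (simp add: compose_def restrict_def comp_def)
    then show "\<phi> \<otimes>\<^bsub>BijGroup (carrier P)\<^esub> \<psi> \<in> aug_endo \<inter> Bij (carrier P)"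
      using * by (simp add: BijGroup_def compose_Bij)
  next
    have "(\<lambda>f. f) \<in> aug_endo"
      by (auto simp: aug_endo_def intro: ring_hom_memI)
    then show "\<one>\<^bsub>BijGroup (carrier P)\<^esub> \<in> aug_endo \<inter> Bij (carrier P)"
      using aug_endo_restrict by (simp add: BijGroup_def id_Bij)
  next
    fix \<phi> assume "\<phi> \<in> aug_endo \<inter> Bij (carrier P)"
    then show "inv\<^bsub>BijGroup (carrier P)\<^esub> \<phi> \<in> aug_endo \<inter> Bij (carrier P)"
      using aug_endo_inv[of \<phi>] restrict_inv_into_Bij[of \<phi> "carrier P"] by (simp add: inv_BijGroup)
  qed (auto simp: BijGroup_def)
qed

text \<open>The coset of \<open>X\<^sub>i\<close> modulo \<open>\<F> 2\<close> is mapped to itself, hence it contains the value at \<open>X\<^sub>i\<close>.\<close>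
lemma GIcD:
  assumes "\<phi> \<in> GIc R n"
  shows "\<phi> \<in> carrier (GAc R n)" and "scalar_linear_part \<one> \<phi>"
proof -
  define Q where "Q = P Quot \<F> 2"
  have \<phi>: "\<phi> \<in> carrier (GAc R n)"
    and ker: "(\<lambda>C\<in>carrier Q. \<phi> ` C) = (\<lambda>C\<in>carrier Q. C)"
    using assms unfolding GIc_def Let_def kernel_def var_ideal_eq ideal_power_eq Q_def
    by (simp_all add: ring_aut_group_def BijGroup_def)
  show "\<phi> \<in> carrier (GAc R n)" by (rule \<phi>)
  show "scalar_linear_part \<one> \<phi>"
    unfolding scalar_linear_part_def
  proof
    fix i assume i: "i \<in> {1..n}"
    have v: "var i \<in> carrier P" using i by (rule var_closed)
    define C where "C = \<F> 2 +>\<^bsub>P\<^esub> var i"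
    have "C \<in> carrier Q"
      using v by (auto simp: Q_def C_def FactRing_def A_RCOSETS_def')
    then have "\<phi> ` C = C" using fun_cong[OF ker, of C] by simp
    moreover have "var i \<in> C" using v by (simp add: C_def F_coset_iff)
    ultimately have "\<phi> (var i) \<in> C" by blast
    then show "agree 2 (\<phi> (var i)) (const \<one> \<otimes>\<^bsub>P\<^esub> var i)"
      using v by (simp add: C_def F_coset_iff flip: one_P)
  qed
qed

section \<open>Solving the commutator equation degree by degree\<close>

lemma linear_leading_F1:
  assumes "p \<in> carrier P" "agree 2 p (const b \<otimes>\<^bsub>P\<^esub> var i)" "b \<in> carrier R" "i \<in> {1..n}"
  shows "p \<in> \<F> 1"
proof (rule agree_F)
  show "agree 1 p (const b \<otimes>\<^bsub>P\<^esub> var i)" using assms(2) by (rule agree_mono) simp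
  show "const b \<otimes>\<^bsub>P\<^esub> var i \<in> \<F> 1"
    by (rule F_mult_left[OF const_closed[OF assms(3)] var_F[OF assms(4)]])
qed (rule assms)

text \<open>The first-order effect of perturbing both factors of a composite in degree \<open>N\<close>.  Split
  \<open>q i = c X\<^sub>i + r\<close> with \<open>r\<close> of order 2.  The perturbation \<open>s\<close> of the substituted tuple acts on the linear
  term as \<open>c s\<close>, and on \<open>r\<close> only in degrees above \<open>N\<close>, by \<open>agree_endo_F\<close>.  On the
  perturbation \<open>t\<close>, the substitution acts as \<open>b\<^sup>N\<close>, by \<open>scalar_leading_term\<close>.\<close>
lemma subst_perturb:
  fixes p q s t :: "nat \<Rightarrow> nat multiset \<Rightarrow> 'a"
  assumes N: "N \<ge> 2" and b: "b \<in> carrier R" and c: "c \<in> carrier R"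
    and p: "\<And>i. i \<in> {1..n} \<Longrightarrow> p i \<in> carrier P" "\<And>i. i \<in> {1..n} \<Longrightarrow> agree 2 (p i) (const b \<otimes>\<^bsub>P\<^esub> var i)"
    and q: "\<And>i. i \<in> {1..n} \<Longrightarrow> q i \<in> carrier P" "\<And>i. i \<in> {1..n} \<Longrightarrow> agree 2 (q i) (const c \<otimes>\<^bsub>P\<^esub> var i)"
    and s: "\<And>i. i \<in> {1..n} \<Longrightarrow> s i \<in> \<F> N" and t: "\<And>i. i \<in> {1..n} \<Longrightarrow> t i \<in> \<F> N"
    and i: "i \<in> {1..n}"
  shows "agree (Suc N) (subst (\<lambda>i. p i \<oplus>\<^bsub>P\<^esub> s i) (q i \<oplus>\<^bsub>P\<^esub> t i))
    (subst p (q i) \<oplus>\<^bsub>P\<^esub> (const c \<otimes>\<^bsub>P\<^esub> s i \<oplus>\<^bsub>P\<^esub> const (b [^] N) \<otimes>\<^bsub>P\<^esub> t i))"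
proof -
  define p' where "p' = (\<lambda>i. p i \<oplus>\<^bsub>P\<^esub> s i)"
  have sP: "s i \<in> carrier P" and tP: "t i \<in> carrier P" if "i \<in> {1..n}" for i
    using that s t F_carrier by auto
  have pF: "p i \<in> \<F> 1" if "i \<in> {1..n}" for i
    using p that b by (intro linear_leading_F1)
  have p'F: "p' i \<in> \<F> 1" if "i \<in> {1..n}" for i
    unfolding p'_def using N by (intro F_add pF that F_mono[OF s[OF that]]) simp
  have agr: "agree N (p' i) (p i)" if "i \<in> {1..n}" for i
    using p(1)[OF that] s[OF that] by (simp add: p'_def agree_def coeff_add vanishing_below_def)
  define \<phi> where "\<phi> = subst p"
  define \<phi>' where "\<phi>' = subst p'"
  have \<phi>: "\<phi> \<in> aug_endo" "\<And>i. i \<in> {1..n} \<Longrightarrow> \<phi> (var i) = p i"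
    unfolding \<phi>_def using pF by (auto intro!: subst_aug_endo subst_var)
  have \<phi>': "\<phi>' \<in> aug_endo" "\<And>i. i \<in> {1..n} \<Longrightarrow> \<phi>' (var i) = p' i"
    unfolding \<phi>'_def using p'F by (auto intro!: subst_aug_endo subst_var)
  have lin: "scalar_linear_part b \<phi>'"
    unfolding scalar_linear_part_def
    using \<phi>'(2) agree_trans[OF agree_mono[OF agr N] p(2)] by simp
  define cX where "cX = const c \<otimes>\<^bsub>P\<^esub> var i"
  have v: "var i \<in> carrier P" using i by (rule var_closed)
  have cX: "cX \<in> carrier P" using c v by (simp add: cX_def)
  define r where "r = q i \<ominus>\<^bsub>P\<^esub> cX"
  have r: "r \<in> \<F> 2"
    unfolding r_def using q[OF i] cX by (simp add: cX_def flip: agree_iff_minus)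
  have rP: "r \<in> carrier P" using r by (rule F_carrier)
  have qi: "q i = cX \<oplus>\<^bsub>P\<^esub> r"
    using q(1)[OF i] cX by (simp add: r_def P.minus_eq P.a_lcomm[of cX] P.r_neg)
  have \<phi>cX: "\<phi> cX = const c \<otimes>\<^bsub>P\<^esub> p i"
    using \<phi> c v i by (simp add: cX_def aug_endo_mult aug_endo_const)
  have \<phi>'cX: "\<phi>' cX = const c \<otimes>\<^bsub>P\<^esub> p i \<oplus>\<^bsub>P\<^esub> const c \<otimes>\<^bsub>P\<^esub> s i"
    using \<phi>' c v i p(1)[OF i] sP[OF i]
    by (simp add: cX_def aug_endo_mult aug_endo_const p'_def P.r_distr)
  have "agree (Suc N) (\<phi>' r) (\<phi> r)"
  proof -
    have "Suc (N - 1) = N" using N by simp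
    then have "agree (N - 1 + 2) (\<phi>' r) (\<phi> r)"
      using agree_endo_F[OF \<phi>'(1) \<phi>(1) _ r, of "N - 1"] agr \<phi>(2) \<phi>'(2) by simp
    then show ?thesis using N by simp
  qed
  moreover have "agree (Suc N) (\<phi>' (t i)) (const (b [^] N) \<otimes>\<^bsub>P\<^esub> t i)"
    by (rule scalar_leading_term[OF \<phi>'(1) b lin t[OF i]])
  moreover have "\<phi>' (q i \<oplus>\<^bsub>P\<^esub> t i) = \<phi>' cX \<oplus>\<^bsub>P\<^esub> (\<phi>' r \<oplus>\<^bsub>P\<^esub> \<phi>' (t i))"
    using \<phi>'(1) cX rP tP[OF i] by (simp add: qi aug_endo_add P.a_assoc)
  ultimately have "agree (Suc N) (\<phi>' (q i \<oplus>\<^bsub>P\<^esub> t i))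
      (\<phi>' cX \<oplus>\<^bsub>P\<^esub> (\<phi> r \<oplus>\<^bsub>P\<^esub> const (b [^] N) \<otimes>\<^bsub>P\<^esub> t i))"
    by (auto intro!: agree_add)
  moreover have "\<phi>' cX \<oplus>\<^bsub>P\<^esub> (\<phi> r \<oplus>\<^bsub>P\<^esub> const (b [^] N) \<otimes>\<^bsub>P\<^esub> t i)
      = \<phi> (q i) \<oplus>\<^bsub>P\<^esub> (const c \<otimes>\<^bsub>P\<^esub> s i \<oplus>\<^bsub>P\<^esub> const (b [^] N) \<otimes>\<^bsub>P\<^esub> t i)"
  proof -
    have cl: "const c \<otimes>\<^bsub>P\<^esub> p i \<in> carrier P" "const c \<otimes>\<^bsub>P\<^esub> s i \<in> carrier P" "\<phi> r \<in> carrier P"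
      "const (b [^] N) \<otimes>\<^bsub>P\<^esub> t i \<in> carrier P"
      using b c p(1)[OF i] sP[OF i] tP[OF i] \<phi>(1) rP by simp_all
    have "\<phi> (q i) = const c \<otimes>\<^bsub>P\<^esub> p i \<oplus>\<^bsub>P\<^esub> \<phi> r"
      using \<phi>(1) cX rP by (simp add: qi aug_endo_add \<phi>cX)
    then show ?thesis
      using cl by (simp add: \<phi>'cX P.a_ac)
  qed
  ultimately show ?thesis
    by (simp add: \<phi>_def \<phi>'_def p'_def)
qed

text \<open>The substitutions of \<open>p\<close> and \<open>q\<close> play the roles of \<open>\<phi>\<close> and \<open>\<psi>\<close>: on the variable \<open>X\<^sub>i\<close>, the sides of
  \<open>\<phi> \<circ> \<psi> = f \<circ> \<psi> \<circ> \<phi>\<close> take the values \<open>\<phi> (q i)\<close> and \<open>f (\<psi> (p i))\<close>.\<close>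
definition solves_below ::
    "((nat multiset \<Rightarrow> 'a) \<Rightarrow> (nat multiset \<Rightarrow> 'a)) \<Rightarrow> 'a \<Rightarrow> 'a \<Rightarrow> nat
      \<Rightarrow> (nat \<Rightarrow> nat multiset \<Rightarrow> 'a) \<Rightarrow> (nat \<Rightarrow> nat multiset \<Rightarrow> 'a) \<Rightarrow> bool"
  where "solves_below f b c N p q \<longleftrightarrow> (\<forall>i\<in>{1..n}.
    p i \<in> carrier P \<and> agree 2 (p i) (const b \<otimes>\<^bsub>P\<^esub> var i) \<and>
    q i \<in> carrier P \<and> agree 2 (q i) (const c \<otimes>\<^bsub>P\<^esub> var i) \<and>
    agree N (subst p (q i)) (f (subst q (p i))))"

lemma solves_below_D:
  assumes "solves_below f b c N p q" "b \<in> carrier R" "c \<in> carrier R"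
  shows "i \<in> {1..n} \<Longrightarrow> p i \<in> carrier P" "i \<in> {1..n} \<Longrightarrow> agree 2 (p i) (const b \<otimes>\<^bsub>P\<^esub> var i)"
    "i \<in> {1..n} \<Longrightarrow> q i \<in> carrier P" "i \<in> {1..n} \<Longrightarrow> agree 2 (q i) (const c \<otimes>\<^bsub>P\<^esub> var i)"
    "i \<in> {1..n} \<Longrightarrow> agree N (subst p (q i)) (f (subst q (p i)))"
    "i \<in> {1..n} \<Longrightarrow> p i \<in> \<F> 1" "i \<in> {1..n} \<Longrightarrow> q i \<in> \<F> 1"
    "subst p \<in> aug_endo" "subst q \<in> aug_endo"
    "i \<in> {1..n} \<Longrightarrow> subst p (var i) = p i" "i \<in> {1..n} \<Longrightarrow> subst q (var i) = q i"
proof -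
  show pF: "p i \<in> \<F> 1" and qF: "q i \<in> \<F> 1" if "i \<in> {1..n}" for i
    using assms that unfolding solves_below_def by (auto intro!: linear_leading_F1 simp del: One_nat_def)
  show "subst p \<in> aug_endo" "subst q \<in> aug_endo"
    using pF qF by (simp_all only: subst_aug_endo)
  show "subst p (var i) = p i" "subst q (var i) = q i" if "i \<in> {1..n}"
    using pF qF that by (simp_all only: subst_var)
qed (use assms in \<open>simp_all add: solves_below_def\<close>)

text \<open>Scalar substitutions commute, and \<open>f\<close> is the identity modulo \<open>\<F> 2\<close> on series without constant term.\<close>
lemma solves_below_start:
  assumes f: "f \<in> aug_endo" and lin: "scalar_linear_part \<one> f"
    and b: "b \<in> carrier R" and c: "c \<in> carrier R"
  shows "solves_below f b c 2 (\<lambda>i. const b \<otimes>\<^bsub>P\<^esub> var i) (\<lambda>i. const c \<otimes>\<^bsub>P\<^esub> var i)"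
proof -
  define p where "p = (\<lambda>i. const b \<otimes>\<^bsub>P\<^esub> var i)"
  define q where "q = (\<lambda>i. const c \<otimes>\<^bsub>P\<^esub> var i)"
  have F: "p i \<in> \<F> 1" "q i \<in> \<F> 1" if "i \<in> {1..n}" for i
    unfolding p_def q_def
    by (rule F_mult_left[OF const_closed[OF b] var_F[OF that]])
      (rule F_mult_left[OF const_closed[OF c] var_F[OF that]])
  have \<phi>: "subst p \<in> aug_endo" "subst q \<in> aug_endo"
    using F by (simp_all only: subst_aug_endo)
  have "agree 2 (subst p (q i)) (f (subst q (p i)))" if i: "i \<in> {1..n}" for i
  proof -
    have v: "var i \<in> carrier P" using i by (rule var_closed)
    have "subst p (q i) = const c \<otimes>\<^bsub>P\<^esub> (const b \<otimes>\<^bsub>P\<^esub> var i)"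
      "subst q (p i) = const b \<otimes>\<^bsub>P\<^esub> (const c \<otimes>\<^bsub>P\<^esub> var i)"
      using \<phi> v b c subst_var[OF F(1) i] subst_var[OF F(2) i]
      by (simp_all add: p_def q_def aug_endo_mult aug_endo_const)
    then have eq: "subst p (q i) = subst q (p i)"
      using v b c by (simp add: P.m_lcomm)
    have "subst q (p i) \<in> \<F> 1"
      by (rule aug_endo_F1[OF \<phi>(2) F(1)[OF i]])
    then have "agree (Suc 1) (f (subst q (p i))) (const (\<one> [^] (1::nat)) \<otimes>\<^bsub>P\<^esub> subst q (p i))"
      by (rule scalar_leading_term[OF f one_closed lin])
    moreover have "subst q (p i) \<in> carrier P"
      using \<phi>(2) F_carrier[OF F(1)[OF i]] by simp
    ultimately show ?thesis
      by (simp add: eq agree_sym numeral_2_eq_2 flip: one_P)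
  qed
  then show ?thesis
    using F_carrier[OF F(1)] F_carrier[OF F(2)] unfolding solves_below_def p_def q_def by simp
qed

text \<open>By \<open>subst_perturb\<close>, applied once to \<open>\<phi> \<circ> \<psi>\<close> and once with the roles of \<open>\<phi>\<close> and \<open>\<psi>\<close> exchanged, the two
  sides change in degree \<open>N\<close> by \<open>c s + b\<^sup>N t\<close> and \<open>b t + c\<^sup>N s\<close>, the latter being unaffected by \<open>f\<close> in
  this degree.  Multiples of the error \<open>e\<close> that cancel it exist because \<open>b\<^bsup>N-1\<^esup> - 1\<close> and
  \<open>c\<^bsup>N-1\<^esup> - 1\<close> generate the unit ideal.\<close>
lemma solves_below_step:
  assumes f: "f \<in> aug_endo" and lin: "scalar_linear_part \<one> f"
    and b: "b \<in> Units R" and c: "c \<in> Units R"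
    and x: "x \<in> carrier R" and y: "y \<in> carrier R" and N: "N \<ge> 2"
    and one: "x \<otimes> (b [^] (N - 1) \<ominus> \<one>) \<oplus> y \<otimes> (c [^] (N - 1) \<ominus> \<one>) = \<one>"
    and sol: "solves_below f b c N p q"
  obtains p' q' where "solves_below f b c (Suc N) p' q'"
    "\<And>i. i \<in> {1..n} \<Longrightarrow> agree N (p' i) (p i)" "\<And>i. i \<in> {1..n} \<Longrightarrow> agree N (q' i) (q i)"
proof -
  have bc: "b \<in> carrier R" "c \<in> carrier R" "inv b \<in> carrier R" "inv c \<in> carrier R"
    using b c by auto
  note pq = solves_below_D[OF sol bc(1,2)]
  define e where "e = (\<lambda>i. subst p (q i) \<ominus>\<^bsub>P\<^esub> f (subst q (p i)))"
  define s where "s = (\<lambda>i. const (inv c \<otimes> y) \<otimes>\<^bsub>P\<^esub> e i)"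
  define t where "t = (\<lambda>i. const (\<ominus> (inv b \<otimes> x)) \<otimes>\<^bsub>P\<^esub> e i)"
  have val: "subst p (q i) \<in> carrier P" "subst q (p i) \<in> carrier P" "f (subst q (p i)) \<in> carrier P"
    if "i \<in> {1..n}" for i
    using that pq f by simp_all
  have e: "e i \<in> \<F> N" if "i \<in> {1..n}" for i
    unfolding e_def using val[OF that] pq(5)[OF that] by (simp flip: agree_iff_minus)
  have s: "s i \<in> \<F> N" and t: "t i \<in> \<F> N" if "i \<in> {1..n}" for i
    unfolding s_def t_def using e[OF that] bc x y by (simp_all add: F_mult_left)
  define p' where "p' = (\<lambda>i. p i \<oplus>\<^bsub>P\<^esub> s i)"
  define q' where "q' = (\<lambda>i. q i \<oplus>\<^bsub>P\<^esub> t i)"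
  have agr: "agree N (p' i) (p i)" "agree N (q' i) (q i)" if "i \<in> {1..n}" for i
    using pq(1,3)[OF that] s[OF that] t[OF that]
    by (simp_all add: p'_def q'_def agree_def coeff_add vanishing_below_def)
  have cl: "p' i \<in> carrier P" "q' i \<in> carrier P" if "i \<in> {1..n}" for i
    using pq(1,3)[OF that] F_carrier[OF s[OF that]] F_carrier[OF t[OF that]]
    by (simp_all add: p'_def q'_def)
  have lin': "agree 2 (p' i) (const b \<otimes>\<^bsub>P\<^esub> var i)" "agree 2 (q' i) (const c \<otimes>\<^bsub>P\<^esub> var i)"
    if "i \<in> {1..n}" for i
    using agree_trans[OF agree_mono[OF agr(1)[OF that] N] pq(2)[OF that]]
      agree_trans[OF agree_mono[OF agr(2)[OF that] N] pq(4)[OF that]] by simp_all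
  have q'F: "q' i \<in> \<F> 1" if "i \<in> {1..n}" for i
    using cl(2)[OF that] lin'(2)[OF that] bc(2) that by (rule linear_leading_F1)
  have \<psi>': "subst q' \<in> aug_endo"
    using q'F by (rule subst_aug_endo)
  have "agree (Suc N) (subst p' (q' i)) (f (subst q' (p' i)))" if i: "i \<in> {1..n}" for i
  proof -
    define w where "w = const b \<otimes>\<^bsub>P\<^esub> t i \<oplus>\<^bsub>P\<^esub> const (c [^] N) \<otimes>\<^bsub>P\<^esub> s i"
    have stP: "s i \<in> carrier P" "t i \<in> carrier P" using s t i F_carrier by auto
    have w: "w \<in> \<F> N"
      unfolding w_def using bc s[OF i] t[OF i] by (simp add: F_add F_mult_left)
    have wP: "w \<in> carrier P" using w by (rule F_carrier)
    have left: "agree (Suc N) (subst p' (q' i))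
        (subst p (q i) \<oplus>\<^bsub>P\<^esub> (const c \<otimes>\<^bsub>P\<^esub> s i \<oplus>\<^bsub>P\<^esub> const (b [^] N) \<otimes>\<^bsub>P\<^esub> t i))"
      unfolding p'_def q'_def
      by (rule subst_perturb[OF N bc(1,2) pq(1,2,3,4) s t i])
    have "agree (Suc N) (subst q' (p' i)) (subst q (p i) \<oplus>\<^bsub>P\<^esub> w)"
      unfolding p'_def q'_def w_def
      by (rule subst_perturb[OF N bc(2,1) pq(3,4,1,2) t s i])
    then have "agree (Suc N) (f (subst q' (p' i))) (f (subst q (p i) \<oplus>\<^bsub>P\<^esub> w))"
      by (rule aug_endo_agree[OF f, rotated 2]) (use \<psi>' cl(1)[OF i] val[OF i] wP in simp_all)
    also have "f (subst q (p i) \<oplus>\<^bsub>P\<^esub> w) = f (subst q (p i)) \<oplus>\<^bsub>P\<^esub> f w"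
      using f val[OF i] wP by (simp add: aug_endo_add)
    also have "agree (Suc N) (f (subst q (p i)) \<oplus>\<^bsub>P\<^esub> f w) (f (subst q (p i)) \<oplus>\<^bsub>P\<^esub> w)"
      using scalar_leading_term[OF f one_closed lin w] wP
      by (intro agree_add) (simp_all flip: one_P)
    finally have right: "agree (Suc N) (f (subst q' (p' i))) (f (subst q (p i)) \<oplus>\<^bsub>P\<^esub> w)" .
    have "(subst p (q i) \<oplus>\<^bsub>P\<^esub> (const c \<otimes>\<^bsub>P\<^esub> s i \<oplus>\<^bsub>P\<^esub> const (b [^] N) \<otimes>\<^bsub>P\<^esub> t i)) m
        = (f (subst q (p i)) \<oplus>\<^bsub>P\<^esub> w) m" for m
    proof -
      define \<epsilon> where "\<epsilon> = e i m"
      define \<omega> where "\<omega> = f (subst q (p i)) m"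
      have eP: "e i \<in> carrier P" using e[OF i] by (rule F_carrier)
      have m: "\<epsilon> \<in> carrier R" "\<omega> \<in> carrier R"
        using eP val[OF i] by (simp_all add: \<epsilon>_def \<omega>_def)
      have "subst p (q i) m = \<omega> \<oplus> \<epsilon>"
        using val[OF i] by (simp add: \<epsilon>_def \<omega>_def e_def coeff_minus minus_eq a_lcomm r_neg)
      moreover have "(const c \<otimes>\<^bsub>P\<^esub> s i) m = y \<otimes> \<epsilon>"
        using bc y eP m c stP by (simp add: s_def coeff_const_mult \<epsilon>_def flip: m_assoc)
      moreover have bt: "b \<otimes> t i m = \<ominus> (x \<otimes> \<epsilon>)"
        using bc x eP m b by (simp add: t_def coeff_const_mult \<epsilon>_def l_minus r_minus flip: m_assoc)
      moreover have cs: "c \<otimes> s i m = y \<otimes> \<epsilon>"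
        using bc y eP m c by (simp add: s_def coeff_const_mult \<epsilon>_def flip: m_assoc)
      moreover have pow: "u [^] N \<otimes> v = u [^] (N - 1) \<otimes> (u \<otimes> v)"
        if "u \<in> carrier R" "v \<in> carrier R" for u v
      proof -
        have "N = Suc (N - 1)" using N by simp
        then have "u [^] N = u [^] (N - 1) \<otimes> u" by (metis nat_pow_Suc)
        then show ?thesis using that by (simp add: m_assoc)
      qed
      ultimately show ?thesis
        using correction_identity[OF x y _ _ m one] bc stP m
        by (simp add: coeff_add w_def coeff_const_mult pow \<omega>_def[symmetric] coeff_closed)
    qed
    then have "subst p (q i) \<oplus>\<^bsub>P\<^esub> (const c \<otimes>\<^bsub>P\<^esub> s i \<oplus>\<^bsub>P\<^esub> const (b [^] N) \<otimes>\<^bsub>P\<^esub> t i)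
        = f (subst q (p i)) \<oplus>\<^bsub>P\<^esub> w" by blast
    then show ?thesis
      using left right by (auto intro: agree_trans agree_sym)
  qed
  then have "solves_below f b c (Suc N) p' q'"
    using cl lin' by (simp add: solves_below_def)
  then show thesis using agr that by blast
qed

text \<open>Iterating the correction step from degree 2 on changes the tuples only in higher and higher
  degrees.  Modulo \<open>\<F> N\<close> both sides of the equation for the limits agree with those for the \<open>N\<close>-th approximation,
  since substitution depends continuously on both arguments.\<close>
lemma solution_exists:
  assumes f: "f \<in> aug_endo" and lin: "scalar_linear_part \<one> f"
    and b: "b \<in> Units R" and c: "c \<in> Units R"
    and comax: "\<And>m::nat. m \<ge> 1 \<Longrightarrow>
      \<exists>x\<in>carrier R. \<exists>y\<in>carrier R. x \<otimes> (b [^] m \<ominus> \<one>) \<oplus> y \<otimes> (c [^] m \<ominus> \<one>) = \<one>"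
  shows "\<exists>p q. \<forall>N. solves_below f b c N p q"
proof -
  have bc: "b \<in> carrier R" "c \<in> carrier R" using b c by auto
  have "\<exists>z. \<forall>N. solves_below f b c (N + 2) (fst (z N)) (snd (z N)) \<and>
      (\<forall>i\<in>{1..n}. agree (N + 2) (fst (z (Suc N)) i) (fst (z N) i)
        \<and> agree (N + 2) (snd (z (Suc N)) i) (snd (z N) i))"
  proof (rule dependent_nat_choice)
    show "\<exists>z. solves_below f b c (0 + 2) (fst z) (snd z)"
      using solves_below_start[OF f lin bc] by (metis add_0 fst_conv snd_conv)
  next
    fix z N assume sol: "solves_below f b c (N + 2) (fst z) (snd z)"
    obtain x y where xy: "x \<in> carrier R" "y \<in> carrier R"
      "x \<otimes> (b [^] (N + 2 - 1) \<ominus> \<one>) \<oplus> y \<otimes> (c [^] (N + 2 - 1) \<ominus> \<one>) = \<one>"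
      using comax[of "N + 2 - 1"] by auto
    obtain p' q' where "solves_below f b c (Suc (N + 2)) p' q'"
      "\<And>i. i \<in> {1..n} \<Longrightarrow> agree (N + 2) (p' i) (fst z i)"
      "\<And>i. i \<in> {1..n} \<Longrightarrow> agree (N + 2) (q' i) (snd z i)"
      using solves_below_step[OF f lin b c xy(1,2) _ xy(3) sol] by auto
    then show "\<exists>z'. solves_below f b c (Suc N + 2) (fst z') (snd z') \<and>
        (\<forall>i\<in>{1..n}. agree (N + 2) (fst z' i) (fst z i) \<and> agree (N + 2) (snd z' i) (snd z i))"
      by (intro exI[of _ "(p', q')"]) simp
  qed
  then obtain z where sol: "\<And>N. solves_below f b c (N + 2) (fst (z N)) (snd (z N))"
    and agr: "\<And>N i. i \<in> {1..n} \<Longrightarrow> agree (N + 2) (fst (z (Suc N)) i) (fst (z N) i)"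
      "\<And>N i. i \<in> {1..n} \<Longrightarrow> agree (N + 2) (snd (z (Suc N)) i) (snd (z N) i)"
    by blast
  note zD = solves_below_D[OF sol bc]
  define p where "p = (\<lambda>i. limit (\<lambda>N. fst (z N) i))"
  define q where "q = (\<lambda>i. limit (\<lambda>N. snd (z N) i))"
  have pP: "p i \<in> carrier P" and qP: "q i \<in> carrier P" if "i \<in> {1..n}" for i
    unfolding p_def q_def by (rule limit_closed, rule zD(1)[OF that], rule limit_closed, rule zD(3)[OF that])
  have p: "agree N (p i) (fst (z N) i)" and q: "agree N (q i) (snd (z N) i)"
    if "i \<in> {1..n}" for i N
    unfolding p_def q_def
    by (rule agree_limit, rule agree_mono[OF agr(1)[OF that]], simp,
        rule agree_limit, rule agree_mono[OF agr(2)[OF that]], simp)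
  have lin_p: "agree 2 (p i) (const b \<otimes>\<^bsub>P\<^esub> var i)" and lin_q: "agree 2 (q i) (const c \<otimes>\<^bsub>P\<^esub> var i)"
    if "i \<in> {1..n}" for i
    using agree_trans[OF p[OF that] zD(2)[OF that]] agree_trans[OF q[OF that] zD(4)[OF that]]
    by blast+
  have pF: "p i \<in> \<F> 1" and qF: "q i \<in> \<F> 1" if "i \<in> {1..n}" for i
    using linear_leading_F1[OF pP[OF that] lin_p[OF that] bc(1) that]
      linear_leading_F1[OF qP[OF that] lin_q[OF that] bc(2) that] by blast+
  have \<phi>: "subst p \<in> aug_endo" "\<And>i. i \<in> {1..n} \<Longrightarrow> subst p (var i) = p i"
    and \<psi>: "subst q \<in> aug_endo" "\<And>i. i \<in> {1..n} \<Longrightarrow> subst q (var i) = q i"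
    using pF qF by (simp_all only: subst_aug_endo subst_var)
  have \<phi>_agree: "agree N (subst p g) (subst (fst (z N)) g)"
    and \<psi>_agree: "agree N (subst q g) (subst (snd (z N)) g)" if "g \<in> carrier P" for g N
    by (rule agree_endo[OF \<phi>(1) zD(8)[of N] _ that], simp only: \<phi>(2) zD(10) p,
        rule agree_endo[OF \<psi>(1) zD(9)[of N] _ that], simp only: \<psi>(2) zD(11) q)
  have "agree N (subst p (q i)) (f (subst q (p i)))" if i: "i \<in> {1..n}" for i N
  proof -
    define p\<^sub>N where "p\<^sub>N = fst (z N)"
    define q\<^sub>N where "q\<^sub>N = snd (z N)"
    have "agree N (subst p (q i)) (subst p\<^sub>N (q i))"
      unfolding p\<^sub>N_def by (rule \<phi>_agree[OF qP[OF i]])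
    also have "agree N (subst p\<^sub>N (q i)) (subst p\<^sub>N (q\<^sub>N i))"
      unfolding p\<^sub>N_def q\<^sub>N_def by (rule aug_endo_agree[OF zD(8) qP[OF i] zD(3)[OF i] q[OF i]])
    also have "agree N (subst p\<^sub>N (q\<^sub>N i)) (f (subst q\<^sub>N (p\<^sub>N i)))"
      unfolding p\<^sub>N_def q\<^sub>N_def by (rule agree_mono[OF zD(5)[OF i]]) simp
    also have "agree N (f (subst q\<^sub>N (p\<^sub>N i))) (f (subst q (p i)))"
    proof (rule aug_endo_agree[OF f])
      have "agree N (subst q\<^sub>N (p\<^sub>N i)) (subst q\<^sub>N (p i))"
        unfolding p\<^sub>N_def q\<^sub>N_def
        by (rule aug_endo_agree[OF zD(9) zD(1)[OF i] pP[OF i] agree_sym[OF p[OF i]]])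
      also have "agree N (subst q\<^sub>N (p i)) (subst q (p i))"
        unfolding q\<^sub>N_def by (rule agree_sym[OF \<psi>_agree[OF pP[OF i]]])
      finally show "agree N (subst q\<^sub>N (p\<^sub>N i)) (subst q (p i))" .
    qed (use zD(9)[of N] zD(1)[OF i, of N] \<psi>(1) pP[OF i] in \<open>simp_all add: p\<^sub>N_def q\<^sub>N_def\<close>)
    finally show ?thesis .
  qed
  then have "solves_below f b c N p q" for N
    using pP qP lin_p lin_q by (simp add: solves_below_def)
  then show ?thesis by blast
qed

lemma scalar_linear_part_GAc:
  assumes "\<phi> \<in> aug_endo" "u \<in> Units R" "scalar_linear_part u \<phi>"
  shows "restrict \<phi> (carrier P) \<in> carrier (GAc R n)"
  unfolding carrier_GAc
  using aug_endo_restrict[OF assms(1)] scalar_linear_part_bij[OF assms]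
  by (simp add: Bij_def bij_betw_restrict_eq)

lemma GIc_single_commutator:
  assumes b: "b \<in> Units R" and c: "c \<in> Units R"
    and comax: "\<And>m::nat. m \<ge> 1 \<Longrightarrow>
      \<exists>x\<in>carrier R. \<exists>y\<in>carrier R. x \<otimes> (b [^] m \<ominus> \<one>) \<oplus> y \<otimes> (c [^] m \<ominus> \<one>) = \<one>"
    and f: "f \<in> GIc R n"
  obtains \<phi> \<psi> where "\<phi> \<in> carrier (GAc R n)" "\<psi> \<in> carrier (GAc R n)"
    "f = \<phi> \<otimes>\<^bsub>GAc R n\<^esub> \<psi> \<otimes>\<^bsub>GAc R n\<^esub> inv\<^bsub>GAc R n\<^esub> \<phi> \<otimes>\<^bsub>GAc R n\<^esub> inv\<^bsub>GAc R n\<^esub> \<psi>"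
proof -
  interpret G: group "GAc R n" by (rule group_GAc)
  have bc: "b \<in> carrier R" "c \<in> carrier R" using b c by auto
  note fG = GIcD(1)[OF f]
  have fE: "f \<in> aug_endo" using fG by (simp add: carrier_GAc)
  obtain p q where sol: "\<And>N. solves_below f b c N p q"
    using solution_exists[OF fE GIcD(2)[OF f] b c comax] by blast
  note pq = solves_below_D[OF sol bc]
  have lin: "scalar_linear_part b (subst p)" "scalar_linear_part c (subst q)"
    using pq(2,4,10,11) by (simp_all add: scalar_linear_part_def)
  define \<phi> where "\<phi> = restrict (subst p) (carrier P)"
  define \<psi> where "\<psi> = restrict (subst q) (carrier P)"
  have \<phi>: "\<phi> \<in> carrier (GAc R n)" and \<psi>: "\<psi> \<in> carrier (GAc R n)"
    unfolding \<phi>_def \<psi>_def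
    by (rule scalar_linear_part_GAc[OF pq(8) b lin(1)], rule scalar_linear_part_GAc[OF pq(9) c lin(2)])
  (* Both composites are augmented endomorphisms, so it suffices to compare them on the variables. *)
  have "(subst p \<circ> subst q) g = (f \<circ> (subst q \<circ> subst p)) g" if "g \<in> carrier P" for g
  proof (rule aug_endo_eqI[OF _ _ _ that])
    show "subst p \<circ> subst q \<in> aug_endo" "f \<circ> (subst q \<circ> subst p) \<in> aug_endo"
      using pq(8,9) fE by (simp_all add: aug_endo_comp)
    show "(subst p \<circ> subst q) (var i) = (f \<circ> (subst q \<circ> subst p)) (var i)" if "i \<in> {1..n}" for i
      using agree_eqI[OF pq(5)[OF that]] pq(10,11)[OF that] by simp
  qed
  then have "compose (carrier P) \<phi> \<psi> = compose (carrier P) f (compose (carrier P) \<psi> \<phi>)"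
    using pq(8,9) by (auto simp: compose_def fun_eq_iff \<phi>_def \<psi>_def)
  moreover have mult: "\<alpha> \<otimes>\<^bsub>GAc R n\<^esub> \<beta> = compose (carrier P) \<alpha> \<beta>"
    if "\<alpha> \<in> carrier (GAc R n)" "\<beta> \<in> carrier (GAc R n)" for \<alpha> \<beta>
    using that unfolding carrier_GAc by (simp add: GAc_eq BijGroup_def)
  ultimately have "\<phi> \<otimes>\<^bsub>GAc R n\<^esub> \<psi> = f \<otimes>\<^bsub>GAc R n\<^esub> (\<psi> \<otimes>\<^bsub>GAc R n\<^esub> \<phi>)"
    using \<phi> \<psi> fG G.m_closed[OF \<psi> \<phi>] by (simp add: mult)
  then have "f = \<phi> \<otimes>\<^bsub>GAc R n\<^esub> \<psi> \<otimes>\<^bsub>GAc R n\<^esub> inv\<^bsub>GAc R n\<^esub> (\<psi> \<otimes>\<^bsub>GAc R n\<^esub> \<phi>)"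
    using \<phi> \<psi> fG G.inv_solve_right[of f "\<phi> \<otimes>\<^bsub>GAc R n\<^esub> \<psi>" "\<psi> \<otimes>\<^bsub>GAc R n\<^esub> \<phi>"] by simp
  then show thesis
    using that[OF \<phi> \<psi>] \<phi> \<psi> by (simp add: G.inv_mult_group G.m_assoc)
qed

end

theorem theorem1p2:
  fixes R (structure) and n :: nat
  assumes "cring R"
    and "\<exists>b\<in>Units R. \<exists>c\<in>Units R. \<forall>m::nat. m \<ge> 1 \<longrightarrow>
           PIdl (b [^] m \<ominus> \<one>) <+> PIdl (c [^] m \<ominus> \<one>) = carrier R"
  shows "GIc R n \<subseteq> commutator_products (GAc R n) 1"
proof
  fix f assume f: "f \<in> GIc R n"
  interpret power_series R n
    using assms(1) by (rule power_series.intro)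
  interpret G: group "GAc R n" by (rule group_GAc)
  obtain b c where b: "b \<in> Units R" and c: "c \<in> Units R"
    and comax: "\<And>m::nat. m \<ge> 1 \<Longrightarrow>
      PIdl (b [^] m \<ominus> \<one>) <+> PIdl (c [^] m \<ominus> \<one>) = carrier R"
    using assms(2) by blast
  have "\<exists>x\<in>carrier R. \<exists>y\<in>carrier R. x \<otimes> (b [^] m \<ominus> \<one>) \<oplus> y \<otimes> (c [^] m \<ominus> \<one>) = \<one>"
    if "m \<ge> 1" for m :: nat
  proof -
    have "\<one> \<in> PIdl (b [^] m \<ominus> \<one>) <+> PIdl (c [^] m \<ominus> \<one>)"
      using comax[OF that] by simp
    then obtain x y where "x \<in> carrier R" "y \<in> carrier R"
      "\<one> = x \<otimes> (b [^] m \<ominus> \<one>) \<oplus> y \<otimes> (c [^] m \<ominus> \<one>)"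
      by (auto simp: set_add_def' cgenideal_def)
    then show ?thesis by metis
  qed
  from GIc_single_commutator[OF b c this f] obtain \<phi> \<psi> where
    \<phi>: "\<phi> \<in> carrier (GAc R n)" and \<psi>: "\<psi> \<in> carrier (GAc R n)" and
    eq: "f = \<phi> \<otimes>\<^bsub>GAc R n\<^esub> \<psi> \<otimes>\<^bsub>GAc R n\<^esub> inv\<^bsub>GAc R n\<^esub> \<phi> \<otimes>\<^bsub>GAc R n\<^esub> inv\<^bsub>GAc R n\<^esub> \<psi>"
    by blast
  have "f \<in> derived_set (GAc R n) (carrier (GAc R n))"
    using \<phi> \<psi> eq by blast
  moreover have "f = \<one>\<^bsub>GAc R n\<^esub> \<otimes>\<^bsub>GAc R n\<^esub> f"
    using GIcD(1)[OF f] by simp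
  ultimately show "f \<in> commutator_products (GAc R n) 1"
    by (auto simp: set_mult_def)
qed

end
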